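(* Let $k\ge 1$, let $C_1,\ldots,C_k>0$ and $M<1/2$ be known real constants, and let $C=C_1+\cdots+C_k$. For $(p_1,\ldots,p_k)\in[0,1]^k$ write $r=C_1p_1+\cdots+C_kp_k$. There exists a multivariate Bernoulli factory for the function $(p_1,\ldots,p_k)\mapsto r$ (a single algorithm, depending on $C_1,\ldots,C_k,M$ but not on the $p_i$), valid for all $(p_1,\ldots,p_k)\in[0,1]^k$ with $r\le M$, such that for every such $(p_1,\ldots,p_k)$ the expected total number of flips used from among the $k$ coins is at most $$\frac{C}{(1-2M)(1+r)}+r\cdot\left[C\,\frac{15.2}{1-2M+r}\right].$$
   Context: $\mathsf{Bern}(q)$ denotes the distribution on $\{0,1\}$ giving mass $q$ to $1$. Multivariate Bernoulli factory: let $D\subseteq[0,1]^k$ be the set of allowed parameter values and $f:D\to[0,1]$ computable. A multivariate Bernoulli factory for $f$ on $D$ is a computable function $\mathcal{A}:[0,1]\times(\{0,1\}^{\{1,2,\ldots\}})^k\to\{0,1\}$ such that, for every $(p_1,\ldots,p_k)\in D$, if $U$ is uniform on $[0,1]$ and $X_{i,j}\sim\mathsf{Bern}(p_i)$ ($1\le i\le k$, $j\ge1$) are all independent, then: (1) there exist random variables $T_1,\ldots,T_k$ with values in the nonnegative integers such that the value of $\mathcal{A}(U,\{X_{1,j}\}_{j\ge1},\ldots,\{X_{k,j}\}_{j\ge1})$ only depends on $U$ and the values of $\{X_{1,j}\}_{j=1}^{T_1},\ldots,\{X_{k,j}\}_{j=1}^{T_k}$, and for all $(t_1,\ldots,t_k)$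 the event $\{(T_1,\ldots,T_k)=(t_1,\ldots,t_k)\}$ is measurable with respect to $U$ and $\{X_{1,j}\}_{j=1}^{t_1},\ldots,\{X_{k,j}\}_{j=1}^{t_k}$; (2) $\mathcal{A}(U,\{X_{1,j}\}_{j\ge1},\ldots,\{X_{k,j}\}_{j\ge1})\sim\mathsf{Bern}(f(p_1,\ldots,p_k))$. The total number of flips used (the running time) is $T_1+\cdots+T_k$. *)

theory Defs
  imports "HOL-Probability.Probability"
begin

section \<open>Computability: a real RAM with coins\<close>

text \<open>
  The auxiliary input of a factory is an exact real number in [0,1], and the factory has to know
  arbitrary real constants.  Computability is therefore taken in the real RAM model: memory cells
  hold exact real numbers; the available operations are field arithmetic, exact comparison,
  indirect addressing, and requesting the next flip of a coin.  Only integer literals occur in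
  programs, so real constants are accessible only if they are supplied as inputs.
\<close>

datatype expr =
    Num int
  | Mem expr
  | Add expr expr
  | Sub expr expr
  | Mul expr expr
  | Div expr expr

datatype test =
    Less expr expr
  | Not test
  | And test test

datatype prog =
    Store expr expr
  | Flip expr expr
  | Seq prog prog
  | Cond test prog prog
  | While test prog

text \<open>Only natural numbers are meaningful as addresses; anything else is read as address 0.\<close>

definition addr :: "real \<Rightarrow> nat" where
  "addr v = (if v \<in> \<nat> then nat \<lfloor>v\<rfloor> else 0)"

primrec val :: "expr \<Rightarrow> (nat \<Rightarrow> real) \<Rightarrow> real" where
  "val (Num z) m = of_int z"
| "val (Mem e) m = m (addr (val e m))"
| "val (Add a b) m = val a m + val b m"
| "val (Sub a b) m = val a m - val b m"
| "val (Mul a b) m = val a m * val b m"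
| "val (Div a b) m = val a m / val b m"

primrec holds :: "test \<Rightarrow> (nat \<Rightarrow> real) \<Rightarrow> bool" where
  "holds (Less a b) m = (val a m < val b m)"
| "holds (Not b) m = (\<not> holds b m)"
| "holds (And a b) m = (holds a m \<and> holds b m)"

text \<open>
  A state consists of the memory and, for every coin, the number of flips of it requested so far.
  Flips are numbered from 1, and \<open>x i j\<close> is the result of the \<open>j\<close>-th flip of coin \<open>i\<close>.
\<close>

type_synonym state = "(nat \<Rightarrow> real) \<times> (nat \<Rightarrow> nat)"

inductive exec :: "(nat \<Rightarrow> nat \<Rightarrow> bool) \<Rightarrow> prog \<Rightarrow> state \<Rightarrow> state \<Rightarrow> bool"
  for x :: "nat \<Rightarrow> nat \<Rightarrow> bool" where
  store: "exec x (Store a e) (m, n) (m(addr (val a m) := val e m), n)"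
| flip: "i = addr (val e m) \<Longrightarrow>
    exec x (Flip a e) (m, n) (m(addr (val a m) := of_bool (x i (Suc (n i)))), n(i := Suc (n i)))"
| seq: "exec x c s s' \<Longrightarrow> exec x d s' s'' \<Longrightarrow> exec x (Seq c d) s s''"
| if_true: "holds b (fst s) \<Longrightarrow> exec x c s s' \<Longrightarrow> exec x (Cond b c d) s s'"
| if_false: "\<not> holds b (fst s) \<Longrightarrow> exec x d s s' \<Longrightarrow> exec x (Cond b c d) s s'"
| while_true: "holds b (fst s) \<Longrightarrow> exec x c s s' \<Longrightarrow> exec x (While b c) s' s'' \<Longrightarrow>
    exec x (While b c) s s''"
| while_false: "\<not> holds b (fst s) \<Longrightarrow> exec x (While b c) s s"

text \<open>The inputs occupy the cells 0, 1, 2, ..., and the output is left in cell 0.\<close>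

definition init :: "real list \<Rightarrow> state" where
  "init vs = ((\<lambda>a. if a < length vs then vs ! a else 0), (\<lambda>_. 0))"

definition outputs :: "prog \<Rightarrow> (nat \<Rightarrow> nat \<Rightarrow> bool) \<Rightarrow> real list \<Rightarrow> real \<Rightarrow> bool" where
  "outputs c x vs v \<longleftrightarrow> (\<exists>m n. exec x c (init vs) (m, n) \<and> m 0 = v)"


section \<open>Multivariate Bernoulli factories\<close>

text \<open>
  An input is a pair \<open>(u, x)\<close> of a number \<open>u\<close> in [0,1] and flips \<open>x i j\<close> with \<open>i \<in> {1..k}\<close> and
  \<open>j \<ge> 1\<close>.  The product measure below is the joint law of independent \<open>U\<close> and \<open>X i j\<close>, where \<open>U\<close>
  is uniform and \<open>X i j\<close> is Bernoulli with parameter \<open>p i\<close>.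
\<close>

type_synonym input = "real \<times> (nat \<Rightarrow> nat \<Rightarrow> bool)"

definition input_law :: "nat \<Rightarrow> (nat \<Rightarrow> real) \<Rightarrow> input measure" where
  "input_law k p =
     restrict_space lborel {0..1} \<Otimes>\<^sub>M
     (\<Pi>\<^sub>M i\<in>{1..k}. \<Pi>\<^sub>M j\<in>{1..}. measure_pmf (bernoulli_pmf (p i)))"

definition inputs :: "nat \<Rightarrow> input measure" where
  "inputs k =
     restrict_space borel {0..1} \<Otimes>\<^sub>M (\<Pi>\<^sub>M i\<in>{1..k}. \<Pi>\<^sub>M j\<in>{1..}. count_space UNIV)"

definition observe :: "nat \<Rightarrow> (nat \<Rightarrow> nat) \<Rightarrow> input \<Rightarrow> input" where
  "observe k t = (\<lambda>(u, x). (u, \<lambda>i\<in>{1..k}. \<lambda>j\<in>{1..t i}. x i j))"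

text \<open>The sigma-algebra generated by \<open>U\<close> and by \<open>X i j\<close> for \<open>i \<in> {1..k}\<close> and \<open>j \<in> {1..t i}\<close>.\<close>

definition observed :: "nat \<Rightarrow> (nat \<Rightarrow> nat) \<Rightarrow> input measure" where
  "observed k t = vimage_algebra (space (inputs k)) (observe k t)
     (restrict_space borel {0..1} \<Otimes>\<^sub>M (\<Pi>\<^sub>M i\<in>{1..k}. \<Pi>\<^sub>M j\<in>{1..t i}. count_space UNIV))"

text \<open>
  \<open>T i\<close> is the number of flips of coin \<open>i\<close> that are used.  As usual for stopping times, the value
  infinity is admitted here for inputs on which the algorithm does not terminate; almost sure
  finiteness is part of the definition of a factory.  Finiteness on every single input would be
  too much to ask: for fixed \<open>u\<close> the sets of \<open>x\<close> with \<open>T = t\<close> are open, so by compactness \<open>T\<close>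
  would be a bounded function of \<open>x\<close>.
\<close>

definition flip_counts :: "nat \<Rightarrow> (input \<Rightarrow> bool) \<Rightarrow> (nat \<Rightarrow> input \<Rightarrow> enat) \<Rightarrow> bool" where
  "flip_counts k A T \<longleftrightarrow>
     (\<forall>i\<in>{1..k}. T i \<in> measurable (inputs k) (count_space UNIV)) \<and>
     (\<forall>t :: nat \<Rightarrow> nat.
        {\<omega> \<in> space (inputs k). \<forall>i\<in>{1..k}. T i \<omega> = enat (t i)} \<in> sets (observed k t)) \<and>
     (\<forall>t :: nat \<Rightarrow> nat. \<forall>\<omega> \<in> space (inputs k). \<forall>\<omega>' \<in> space (inputs k).
        (\<forall>i\<in>{1..k}. T i \<omega> = enat (t i)) \<longrightarrow> observe k t \<omega> = observe k t \<omega>' \<longrightarrow> A \<omega> = A \<omega>')"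

text \<open>
  The list \<open>cs\<close> contains the known real constants, which a program receives after its proper
  arguments.  A program has no coins other than \<open>1, ..., k\<close>; any other index yields tails.
\<close>

definition computable_fun :: "nat \<Rightarrow> real list \<Rightarrow> (nat \<Rightarrow> real) set \<Rightarrow> ((nat \<Rightarrow> real) \<Rightarrow> real) \<Rightarrow> bool"
  where
  "computable_fun k cs D f \<longleftrightarrow>
     (\<exists>c. \<forall>p\<in>D. outputs c (\<lambda>i j. False) (map p [1..<Suc k] @ cs) (f p))"

definition runs_to :: "nat \<Rightarrow> real list \<Rightarrow> prog \<Rightarrow> input \<Rightarrow> real \<Rightarrow> bool" where
  "runs_to k cs c \<omega> v \<longleftrightarrow> outputs c (\<lambda>i j. i \<in> {1..k} \<and> snd \<omega> i j) (fst \<omega> # cs) v"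

definition computable_factory ::
  "nat \<Rightarrow> real list \<Rightarrow> (nat \<Rightarrow> real) set \<Rightarrow> (input \<Rightarrow> bool) \<Rightarrow> bool" where
  "computable_factory k cs D A \<longleftrightarrow>
     (\<exists>c. (\<forall>\<omega> \<in> space (inputs k). \<forall>v. runs_to k cs c \<omega> v \<longrightarrow> v = of_bool (A \<omega>)) \<and>
          (\<forall>p\<in>D. AE \<omega> in input_law k p. \<exists>v. runs_to k cs c \<omega> v))"

definition multivariate_bernoulli_factory ::
  "nat \<Rightarrow> real list \<Rightarrow> (nat \<Rightarrow> real) set \<Rightarrow> ((nat \<Rightarrow> real) \<Rightarrow> real) \<Rightarrow>
   (input \<Rightarrow> bool) \<Rightarrow> (nat \<Rightarrow> input \<Rightarrow> enat) \<Rightarrow> bool" where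
  "multivariate_bernoulli_factory k cs D f A T \<longleftrightarrow>
     D \<subseteq> ({1..k} \<rightarrow>\<^sub>E {0..1}) \<and> f \<in> D \<rightarrow> {0..1} \<and> computable_fun k cs D f \<and>
     A \<in> measurable (inputs k) (count_space UNIV) \<and>
     computable_factory k cs D A \<and>
     flip_counts k A T \<and>
     (\<forall>p\<in>D. (AE \<omega> in input_law k p. \<forall>i\<in>{1..k}. T i \<omega> < \<infinity>) \<and>
            distr (input_law k p) (count_space UNIV) A = measure_pmf (bernoulli_pmf (f p)))"

definition expected_flips :: "nat \<Rightarrow> (nat \<Rightarrow> real) \<Rightarrow> (nat \<Rightarrow> input \<Rightarrow> enat) \<Rightarrow> ennreal" where
  "expected_flips k p T = (\<integral>\<^sup>+ \<omega>. (\<Sum>i=1..k. ennreal_of_enat (T i \<omega>)) \<partial>input_law k p)"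

lemma sets_input_law: "sets (input_law k p) = sets (inputs k)"
  unfolding input_law_def inputs_def
  by (intro sets_pair_measure_cong sets_PiM_cong refl) (simp_all add: sets_restrict_space)

lemma space_input_law: "space (input_law k p) = space (inputs k)"
  by (rule sets_eq_imp_space_eq) (rule sets_input_law)

lemma prob_space_input_law: "prob_space (input_law k p)"
proof -
  have "prob_space (restrict_space lborel {0..1::real})"
    by (rule prob_space_restrict_space) auto
  moreover have "prob_space (\<Pi>\<^sub>M i\<in>{1..k}. \<Pi>\<^sub>M j\<in>{1..}. measure_pmf (bernoulli_pmf (p i)))"
    by (intro prob_space_PiM measure_pmf.prob_space_axioms)
  ultimately show ?thesis
    unfolding input_law_def by (intro prob_space_pair)
qed

end

theory Submission
  imports Defs
begin

text \<open>
  Let \<open>C = C 1 + ... + C k\<close> and \<open>r = C 1 * p 1 + ... + C k * p k\<close>, and fix \<open>a > 0\<close>.  Consider a race in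
  which coin \<open>i\<close> is flipped at rate \<open>a * C i\<close> and an alarm rings at rate 1.  Heads appear at rate \<open>a * r\<close>,
  so the first event that is not a tail is heads with probability \<open>a * r / (1 + a * r)\<close>, and \<open>a * C / (1 + a * r)\<close>
  flips are expected until then.  An algorithm can run such a race without knowing the \<open>p i\<close>.

  The first race has \<open>a = 1 / (1 - 2 * M)\<close>.  If the alarm rings the output is 0.  After heads, which have
  probability \<open>r / (1 - 2 * M + r)\<close>, the output has to be 1 with probability \<open>1 - 2 * M + r\<close>: it is 1 at
  once with probability \<open>1 - 2 * M\<close>, and otherwise a coin of bias \<open>s / 2\<close> with \<open>s = r / M \<le> 1\<close> is needed.  The
  race costs \<open>C / (1 - 2 * M + r)\<close> flips, which accounts for the first term of the bound, and the second term
  follows once a coin of bias \<open>s / 2\<close> costs at most \<open>15.2 * C / (2 * M)\<close> flips.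

  For this coin, run a walk on the levels \<open>0, 1, 2, ...\<close> whose steps are races with \<open>a = m / M\<close>: heads lead
  down, the alarm leads up.  Then \<open>(m * s) ^ level\<close> is a martingale, so with \<open>m = 1 / 2\<close> and start in level 1
  the walk reaches 0 with probability \<open>s / 2\<close>, but it may also drift to infinity.  Therefore the walk is split
  into stages.  When stage \<open>j\<close> hits its ceiling \<open>top_level j\<close>, the walk either dies (output 0) or goes on from
  the same level with the larger parameter \<open>down (j + 1)\<close>, where the probability of survival is such that the
  probability of finally reaching 0 with acceptance stays \<open>gain j * (down j * s) ^ level\<close>.  The distance of
  \<open>down j\<close> from 1 is halved and the ceiling is doubled from stage to stage, so the cost of a stage grows by the
  factor 4, while by \<open>survive_bounds\<close> every stage but the first one is survived with probability at most
  \<open>1 / 7\<close>.  Hence the expected total cost is finite, and with the numbers chosen here small enough.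

  These algorithms are instances of protocols: decision processes that branch with known probabilities, toss
  coins and halt.  The single probabilistic tool is \<open>supersolution_bound\<close>: if a function of the state
  never increases on average and in addition pays a price for each step, then its initial value bounds the
  expected total price.  Applied to the intended probability of output 1, and to that of output 0, it bounds
  both probabilities from above; with price 1 per step it shows that the protocol halts almost surely, which
  turns the two bounds into equalities; with price 1 per toss it bounds the expected number of flips.
  These consequences are \<open>protocol_factory\<close> and \<open>expected_flips_bound\<close>.  The lemma \<open>extend_supersolution\<close> reduces the four conditions to
  one inequality for each level, which is \<open>target_harmonic\<close> for the probabilities and \<open>cost_race\<close> for the prices.
  A loop that performs one action of the protocol per iteration is a program for the factory
  (\<open>simulates_body\<close>).  If \<open>M \<le> 0\<close>, then \<open>r = 0\<close> for all admissible parameters, and the constant 0 is a factory.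
\<close>

section \<open>Splitting the uniform number and taking off the first flip\<close>

text \<open>A single uniform number supplies all the random choices of a protocol, because a choice by \<open>u < q\<close> leaves
  behind a rescaled number that is again uniform and independent of the choice.  For \<open>q = 0\<close> and \<open>q = 1\<close>
  the division by 0 is confined to a null set.\<close>

lemma nn_integral_split_uniform:
  fixes f g :: "real \<Rightarrow> ennreal"
  assumes q: "0 \<le> q" "q \<le> 1"
    and f: "f \<in> borel_measurable (restrict_space borel {0..1})"
    and g: "g \<in> borel_measurable (restrict_space borel {0..1})"
  defines "U \<equiv> restrict_space lborel {0..1::real}"
  shows "(\<integral>\<^sup>+u. (if u < q then f (u / q) else g ((u - q) / (1 - q))) \<partial>U)
       = ennreal q * (\<integral>\<^sup>+u. f u \<partial>U) + ennreal (1 - q) * (\<integral>\<^sup>+u. g u \<partial>U)"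
proof -
  define F where "F u = f u * indicator {0..1} u" for u
  define G where "G u = g u * indicator {0..1} u" for u
  have [measurable]: "F \<in> borel_measurable borel" "G \<in> borel_measurable borel"
    using f g by (simp_all add: F_def[abs_def] G_def[abs_def] borel_measurable_restrict_space_iff_ennreal)
  have int: "(\<integral>\<^sup>+u. h u \<partial>U) = (\<integral>\<^sup>+u. h u * indicator {0..1} u \<partial>lborel)" for h :: "real \<Rightarrow> ennreal"
    unfolding U_def by (subst nn_integral_restrict_space) auto
  have *: "(if u < q then f (u / q) else g ((u - q) / (1 - q))) * indicator {0..1} u =
     indicator {0..<q} u * F (u / q) + indicator {q..1} u * G ((u - q) / (1 - q))" for u
    using q by (auto simp: F_def G_def indicator_def divide_simps split: if_splits)
  have 1: "(\<integral>\<^sup>+u. indicator {0..<q} u * F (u / q) \<partial>lborel) = ennreal q * (\<integral>\<^sup>+u. F u \<partial>lborel)"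
  proof (cases "q = 0")
    case True
    then show ?thesis by simp
  next
    case False
    have "(\<integral>\<^sup>+u. indicator {0..<q} u * F (u / q) \<partial>lborel)
        = \<bar>q\<bar> * (\<integral>\<^sup>+u. indicator {0..<q} (0 + q * u) * F ((0 + q * u) / q) \<partial>lborel)"
      using False by (intro nn_integral_real_affine) auto
    also have "(\<integral>\<^sup>+u. indicator {0..<q} (0 + q * u) * F ((0 + q * u) / q) \<partial>lborel) = (\<integral>\<^sup>+u. F u \<partial>lborel)"
    proof (rule nn_integral_cong_AE)
      show "AE u in lborel. indicator {0..<q} (0 + q * u) * F ((0 + q * u) / q) = F u"
        using AE_lborel_singleton[of 1]
        by eventually_elim (use False q in \<open>auto simp: F_def indicator_def\<close>)
    qed
    finally show ?thesis using q by simp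
  qed
  have 2: "(\<integral>\<^sup>+u. indicator {q..1} u * G ((u - q) / (1 - q)) \<partial>lborel) = ennreal (1 - q) * (\<integral>\<^sup>+u. G u \<partial>lborel)"
  proof (cases "q = 1")
    case True
    have "(\<integral>\<^sup>+u. indicator {q..1} u * G ((u - q) / (1 - q)) \<partial>lborel) = (\<integral>\<^sup>+u. 0 \<partial>(lborel :: real measure))"
    proof (rule nn_integral_cong_AE)
      show "AE u in lborel. indicator {q..1} u * G ((u - q) / (1 - q)) = 0"
        using AE_lborel_singleton[of 1]
        by eventually_elim (use True in \<open>auto simp: indicator_def\<close>)
    qed
    then show ?thesis using True by simp
  next
    case False
    have "(\<integral>\<^sup>+u. indicator {q..1} u * G ((u - q) / (1 - q)) \<partial>lborel)
        = \<bar>1 - q\<bar> * (\<integral>\<^sup>+u. indicator {q..1} (q + (1 - q) * u) * G ((q + (1 - q) * u - q) / (1 - q)) \<partial>lborel)"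
      using False by (intro nn_integral_real_affine) auto
    also have "(\<integral>\<^sup>+u. indicator {q..1} (q + (1 - q) * u) * G ((q + (1 - q) * u - q) / (1 - q)) \<partial>lborel) = (\<integral>\<^sup>+u. G u \<partial>lborel)"
    proof (rule nn_integral_cong)
      fix u :: real
      have "q + (1 - q) * u \<le> 1 \<longleftrightarrow> (1 - q) * u \<le> (1 - q) * 1" by (simp add: algebra_simps)
      also have "\<dots> \<longleftrightarrow> u \<le> 1" using False q by (subst mult_le_cancel_left_pos) auto
      finally have "q + (1 - q) * u \<in> {q..1} \<longleftrightarrow> u \<in> {0..1}"
        using False q by (auto simp: zero_le_mult_iff)
      then show "indicator {q..1} (q + (1 - q) * u) * G ((q + (1 - q) * u - q) / (1 - q)) = G u"
        using False by (auto simp: G_def indicator_def)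
    qed
    finally show ?thesis using q by simp
  qed
  have "(\<integral>\<^sup>+u. (if u < q then f (u / q) else g ((u - q) / (1 - q))) \<partial>U)
     = (\<integral>\<^sup>+u. indicator {0..<q} u * F (u / q) + indicator {q..1} u * G ((u - q) / (1 - q)) \<partial>lborel)"
    by (simp only: int *)
  also have "\<dots> = (\<integral>\<^sup>+u. indicator {0..<q} u * F (u / q) \<partial>lborel) + (\<integral>\<^sup>+u. indicator {q..1} u * G ((u - q) / (1 - q)) \<partial>lborel)"
    by (intro nn_integral_add) auto
  also have "\<dots> = ennreal q * (\<integral>\<^sup>+u. F u \<partial>lborel) + ennreal (1 - q) * (\<integral>\<^sup>+u. G u \<partial>lborel)"
    by (simp only: 1 2)
  finally show ?thesis by (simp only: int F_def G_def)
qed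

text \<open>The flips of a coin without the first one, numbered from 1 again.  The restriction keeps the sequence in the
  product space, whose elements are \<open>undefined\<close> at 0.\<close>

definition tails :: "(nat \<Rightarrow> bool) \<Rightarrow> nat \<Rightarrow> bool" where
  "tails y = (\<lambda>j\<in>{1..}. y (Suc j))"

lemma measurable_tails [measurable]:
  "tails \<in> (\<Pi>\<^sub>M j\<in>{1..}. count_space UNIV) \<rightarrow>\<^sub>M (\<Pi>\<^sub>M j\<in>{1..}. count_space UNIV)"
  unfolding tails_def[abs_def] by measurable

text \<open>The product over \<open>{1..}\<close> splits into the coordinate 1 and the product over \<open>{2..}\<close>; reindexing along \<open>Suc\<close>
  identifies the latter with the whole product.\<close>

lemma nn_integral_first_flip:
  fixes B :: "bool measure" and f :: "bool \<Rightarrow> (nat \<Rightarrow> bool) \<Rightarrow> ennreal"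
  assumes B: "prob_space B" "sets B = UNIV"
  defines "S \<equiv> \<Pi>\<^sub>M j\<in>{1::nat..}. B"
  assumes f: "\<And>b. f b \<in> borel_measurable S"
  shows "(\<integral>\<^sup>+y. f (y 1) (tails y) \<partial>S) = (\<integral>\<^sup>+b. (\<integral>\<^sup>+y. f b y \<partial>S) \<partial>B)"
proof -
  interpret B: prob_space B by fact
  define S2 where "S2 = (\<Pi>\<^sub>M j\<in>{2::nat..}. B)"
  interpret S2: prob_space S2 unfolding S2_def by (intro prob_space_PiM B)
  have sB: "sets B = sets (count_space UNIV)" using B by simp
  have [measurable_cong]: "sets B = sets (count_space UNIV)" using B by simp
  have [measurable]: "case_prod f \<in> borel_measurable (B \<Otimes>\<^sub>M S)"
  proof -
    have "case_prod f \<in> borel_measurable (count_space UNIV \<Otimes>\<^sub>M S)"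
      using f by (intro measurable_pair_measure_countable1) auto
    then show ?thesis by (simp cong: measurable_cong_sets add: sets_pair_measure_cong[OF sB refl])
  qed
  have tl[measurable]: "tails \<in> S \<rightarrow>\<^sub>M S" 
    unfolding S_def tails_def[abs_def] by measurable
  have tl2[measurable]: "tails \<in> S2 \<rightarrow>\<^sub>M S" 
    unfolding S_def S2_def tails_def[abs_def] by measurable
  have ins: "insert (1::nat) {2..} = {1..}" by auto
  have S: "distr (B \<Otimes>\<^sub>M S2) S (\<lambda>(b, y). y(1 := b)) = S"
    using distr_pair_PiM_eq_PiM[of "{2..}" "\<lambda>_. B" "1::nat"] B unfolding S_def S2_def ins by simp
  have D: "distr S2 S tails = S"
    using distr_PiM_reindex[of "{2..}" "\<lambda>_. B" Suc "{1..}"] B by (auto simp: S_def S2_def tails_def[abs_def])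
  have upd[measurable]: "(\<lambda>(b, y). y(1 := b)) \<in> B \<Otimes>\<^sub>M S2 \<rightarrow>\<^sub>M S"
    unfolding S_def S2_def ins[symmetric] case_prod_beta
    by (rule measurable_fun_upd[where J="{2..}"]) auto
  have one[measurable]: "(\<lambda>y. y 1) \<in> S \<rightarrow>\<^sub>M B" unfolding S_def by measurable
  have "(\<integral>\<^sup>+y. f (y 1) (tails y) \<partial>S) = (\<integral>\<^sup>+y. f (y 1) (tails y) \<partial>distr (B \<Otimes>\<^sub>M S2) S (\<lambda>(b, y). y(1 := b)))"
    by (simp only: S)
  also have "\<dots> = (\<integral>\<^sup>+z. (case z of (b, y) \<Rightarrow> f b (tails y)) \<partial>(B \<Otimes>\<^sub>M S2))"
  proof (subst nn_integral_distr)
    show "(\<integral>\<^sup>+ x. f ((case x of (b, y) \<Rightarrow> y(1 := b)) 1) (tails (case x of (b, y) \<Rightarrow> y(1 := b))) \<partial>(B \<Otimes>\<^sub>M S2)) =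
    (\<integral>\<^sup>+ z. (case z of (b, y) \<Rightarrow> f b (tails y)) \<partial>(B \<Otimes>\<^sub>M S2))"
      by (intro nn_integral_cong) (auto simp: tails_def restrict_def split: prod.splits intro!: arg_cong[where f="f _"])
  qed measurable
  also have "\<dots> = (\<integral>\<^sup>+b. (\<integral>\<^sup>+y. f b (tails y) \<partial>S2) \<partial>B)"
    by (subst S2.nn_integral_fst[symmetric]) auto
  also have "\<dots> = (\<integral>\<^sup>+b. (\<integral>\<^sup>+y. f b y \<partial>distr S2 S tails) \<partial>B)"
    using f by (intro nn_integral_cong, subst nn_integral_distr) auto
  finally show ?thesis by (simp only: D)
qed

definition pop :: "nat \<Rightarrow> (nat \<Rightarrow> nat \<Rightarrow> bool) \<Rightarrow> nat \<Rightarrow> nat \<Rightarrow> bool" where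
  "pop i x = x(i := tails (x i))"

text \<open>The same for one of several coins, by splitting off the factor of that coin and integrating over the others first.\<close>

lemma nn_integral_first_flip_of_coin:
  fixes B :: "nat \<Rightarrow> bool measure" and f :: "bool \<Rightarrow> (nat \<Rightarrow> nat \<Rightarrow> bool) \<Rightarrow> ennreal"
  assumes B: "\<And>i. prob_space (B i)" "\<And>i. sets (B i) = UNIV" and i: "i \<in> I"
  defines "S \<equiv> \<lambda>i. \<Pi>\<^sub>M j\<in>{1::nat..}. B i"
  defines "X \<equiv> PiM I S"
  assumes f[measurable]: "\<And>b. f b \<in> borel_measurable X"
  shows "(\<integral>\<^sup>+x. f (x i 1) (pop i x) \<partial>X) = (\<integral>\<^sup>+b. (\<integral>\<^sup>+x. f b x \<partial>X) \<partial>B i)"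
proof -
  have prob: "prob_space (S i)" for i unfolding S_def by (intro prob_space_PiM B)
  have sS: "sets (S i) = sets (\<Pi>\<^sub>M j\<in>{1::nat..}. count_space UNIV)" for i
    unfolding S_def by (intro sets_PiM_cong refl) (simp add: B)
  have [measurable_cong]: "sets (B i) = sets (count_space UNIV)" for i by (simp add: B)
  define X' where "X' = PiM (I - {i}) S"
  interpret X': prob_space X' unfolding X'_def by (intro prob_space_PiM prob)
  interpret Si: prob_space "S i" by (rule prob)
  have ins: "insert i (I - {i}) = I" using i by auto
  have X: "distr (S i \<Otimes>\<^sub>M X') X (\<lambda>(y, z). z(i := y)) = X"
    using distr_pair_PiM_eq_PiM[of "I - {i}" S i] prob unfolding X_def X'_def ins by simp
  have upd: "(\<lambda>w. (snd w)(i := h (fst w))) \<in> S i \<Otimes>\<^sub>M X' \<rightarrow>\<^sub>M X" if [measurable]: "h \<in> S i \<rightarrow>\<^sub>M S i" for h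
    unfolding X_def X'_def by (rule measurable_fun_upd[where J="I - {i}"]) (use i in auto)
  have tl[measurable]: "tails \<in> S i \<rightarrow>\<^sub>M S i" for i
    unfolding S_def tails_def[abs_def] by measurable
  have upd1[measurable]: "(\<lambda>(y, z). z(i := y)) \<in> S i \<Otimes>\<^sub>M X' \<rightarrow>\<^sub>M X"
    using upd[of "\<lambda>y. y"] by (simp add: case_prod_beta')
  have cmp[measurable]: "(\<lambda>x. x i) \<in> X \<rightarrow>\<^sub>M S i" unfolding X_def using i by measurable
  have one[measurable]: "(\<lambda>y. y (Suc 0)) \<in> S i \<rightarrow>\<^sub>M B i" for i unfolding S_def by measurable
  have pop[measurable]: "pop i \<in> X \<rightarrow>\<^sub>M X"
    unfolding pop_def[abs_def] X_def
    by (rule measurable_fun_upd[where J=I]) (use i cmp[unfolded X_def] in auto)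
  have fst1[measurable]: "(\<lambda>x. f (x i (Suc 0)) (pop i x)) \<in> borel_measurable X"
  proof -
    have "(\<lambda>x. x i (Suc 0)) \<in> X \<rightarrow>\<^sub>M count_space UNIV"
      using measurable_compose[OF cmp one] measurable_cong_sets[OF refl, of "B i" "count_space UNIV" X] B(2)[of i]
      by auto
    then show ?thesis
      by (rule measurable_compose_countable'[where I=UNIV, rotated]) auto
  qed
  define F where "F b y = (\<integral>\<^sup>+z. f b (z(i := y)) \<partial>X')" for b y
  have F[measurable]: "F b \<in> borel_measurable (S i)" for b
    unfolding F_def by measurable
  have "(\<integral>\<^sup>+x. f (x i 1) (pop i x) \<partial>X)
      = (\<integral>\<^sup>+x. f (x i (Suc 0)) (pop i x) \<partial>distr (S i \<Otimes>\<^sub>M X') X (\<lambda>(y, z). z(i := y)))"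
    by (simp only: X One_nat_def)
  also have "\<dots> = (\<integral>\<^sup>+w. f (fst w 1) ((snd w)(i := tails (fst w))) \<partial>(S i \<Otimes>\<^sub>M X'))"
    by (subst nn_integral_distr[OF upd1]) (simp add: fst1, simp add: pop_def case_prod_beta)
  also have "\<dots> = (\<integral>\<^sup>+y. F (y 1) (tails y) \<partial>S i)"
    unfolding F_def using measurable_compose[OF upd1 fst1]
    by (subst X'.nn_integral_fst[symmetric]) (simp_all add: pop_def case_prod_beta)
  also have "\<dots> = (\<integral>\<^sup>+b. (\<integral>\<^sup>+y. F b y \<partial>S i) \<partial>B i)"
    unfolding S_def by (rule nn_integral_first_flip) (use B F in \<open>auto simp: S_def\<close>)
  also have "\<dots> = (\<integral>\<^sup>+b. (\<integral>\<^sup>+x. f b x \<partial>X) \<partial>B i)"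
  proof (rule nn_integral_cong)
    fix b
    have "(\<integral>\<^sup>+x. f b x \<partial>X) = (\<integral>\<^sup>+x. f b x \<partial>distr (S i \<Otimes>\<^sub>M X') X (\<lambda>(y, z). z(i := y)))"
      by (simp only: X)
    also have "\<dots> = (\<integral>\<^sup>+w. f b ((snd w)(i := fst w)) \<partial>(S i \<Otimes>\<^sub>M X'))"
      by (subst nn_integral_distr) (auto simp: case_prod_beta)
    also have "\<dots> = (\<integral>\<^sup>+y. F b y \<partial>S i)"
      unfolding F_def using upd[of "\<lambda>y. y"] by (subst X'.nn_integral_fst[symmetric]) auto
    finally show "(\<integral>\<^sup>+y. F b y \<partial>S i) = (\<integral>\<^sup>+x. f b x \<partial>X)" ..
  qed
  finally show ?thesis .
qed

lemma space_inputs: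
  "space (inputs k) = {0..1} \<times> (\<Pi>\<^sub>E i\<in>{1..k}. \<Pi>\<^sub>E j\<in>{1..}. UNIV)"
  by (simp add: inputs_def space_pair_measure space_PiM space_restrict_space)

lemma measurable_branch:
  assumes q: "0 \<le> q" "q \<le> 1"
    and [measurable]: "f \<in> inputs k \<rightarrow>\<^sub>M N" "g \<in> inputs k \<rightarrow>\<^sub>M N"
  shows "(\<lambda>\<omega>. if fst \<omega> < q then f (fst \<omega> / q, snd \<omega>) else g ((fst \<omega> - q) / (1 - q), snd \<omega>))
           \<in> inputs k \<rightarrow>\<^sub>M N"
proof -
  \<comment> \<open>Clamping to the unit interval makes the rescaled numbers measurable on all inputs, also on those of the other branch.\<close>
  define c :: "real \<Rightarrow> real" where "c v = max 0 (min 1 v)" for v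
  have [measurable]: "fst \<in> borel_measurable (inputs k)"
    unfolding inputs_def by (rule measurable_compose[OF measurable_fst]) (simp add: measurable_restrict_space1)
  have snd: "snd \<in> inputs k \<rightarrow>\<^sub>M (\<Pi>\<^sub>M i\<in>{1..k}. \<Pi>\<^sub>M j\<in>{1..}. count_space UNIV)"
    unfolding inputs_def by measurable
  have c: "(\<lambda>\<omega>. (c (h \<omega>), snd \<omega>)) \<in> inputs k \<rightarrow>\<^sub>M inputs k"
    if [measurable]: "h \<in> borel_measurable (inputs k)" for h
  proof -
    have "(\<lambda>\<omega>. c (h \<omega>)) \<in> inputs k \<rightarrow>\<^sub>M restrict_space borel {0..1}"
      by (rule measurable_restrict_space2) (auto simp: c_def[abs_def])
    then show ?thesis by (subst (2) inputs_def) (intro measurable_Pair snd)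
  qed
  note [measurable] = measurable_compose[OF c]
  have "(\<lambda>\<omega>. if fst \<omega> < q then f (c (fst \<omega> / q), snd \<omega>) else g (c ((fst \<omega> - q) / (1 - q)), snd \<omega>))
           \<in> inputs k \<rightarrow>\<^sub>M N"
    by measurable
  moreover have "(if fst \<omega> < q then f (c (fst \<omega> / q), snd \<omega>) else g (c ((fst \<omega> - q) / (1 - q)), snd \<omega>))
     = (if fst \<omega> < q then f (fst \<omega> / q, snd \<omega>) else g ((fst \<omega> - q) / (1 - q), snd \<omega>))"
    if "\<omega> \<in> space (inputs k)" for \<omega>
  proof -
    have "0 \<le> fst \<omega>" "fst \<omega> \<le> 1" using that by (auto simp: space_inputs)
    then have "fst \<omega> < q \<Longrightarrow> fst \<omega> / q \<in> {0..1}"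
      "\<not> fst \<omega> < q \<Longrightarrow> (fst \<omega> - q) / (1 - q) \<in> {0..1}"
      using q by (auto simp: divide_simps)
    moreover have "c v = v" if "v \<in> {0..1}" for v
      using that by (auto simp: c_def)
    ultimately show ?thesis by auto
  qed
  ultimately show ?thesis by (simp cong: measurable_cong)
qed

lemma measurable_pop:
  assumes "i \<in> {1..k}"
  shows "(\<lambda>\<omega>. (fst \<omega>, pop i (snd \<omega>))) \<in> inputs k \<rightarrow>\<^sub>M inputs k"
proof -
  have "(\<lambda>x. pop i x) \<in> (\<Pi>\<^sub>M i\<in>{1..k}. \<Pi>\<^sub>M j\<in>{1..}. count_space UNIV) \<rightarrow>\<^sub>M (\<Pi>\<^sub>M i\<in>{1..k}. \<Pi>\<^sub>M j\<in>{1..}. count_space (UNIV :: bool set))"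
    unfolding pop_def
    by (rule measurable_fun_upd[where J="{1..k}"])
       (use assms measurable_compose[OF measurable_component_singleton[OF assms] measurable_tails] in auto)
  then show ?thesis unfolding inputs_def by measurable
qed

lemma measurable_toss:
  assumes i: "i \<in> {1..k}"
    and f: "f \<in> inputs k \<rightarrow>\<^sub>M N" and g: "g \<in> inputs k \<rightarrow>\<^sub>M N"
  shows "(\<lambda>\<omega>. if snd \<omega> i 1 then f (fst \<omega>, pop i (snd \<omega>)) else g (fst \<omega>, pop i (snd \<omega>)))
           \<in> inputs k \<rightarrow>\<^sub>M N"
proof -
  have [measurable]: "(\<lambda>\<omega>. snd \<omega> i 1) \<in> inputs k \<rightarrow>\<^sub>M count_space UNIV"
    unfolding inputs_def
    by (rule measurable_compose[OF measurable_snd],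
        rule measurable_compose[OF measurable_component_singleton[OF i] measurable_component_singleton]) simp
  note [measurable] = measurable_compose[OF measurable_pop[OF i] f] measurable_compose[OF measurable_pop[OF i] g]
  show ?thesis by measurable
qed

text \<open>This identity and the next one are the Markov property: after a choice or a flip the remaining input has its
  original law.\<close>

lemma nn_integral_branch:
  assumes q: "0 \<le> q" "q \<le> 1"
    and f[measurable]: "f \<in> borel_measurable (inputs k)" and g[measurable]: "g \<in> borel_measurable (inputs k)"
  shows "(\<integral>\<^sup>+\<omega>. (if fst \<omega> < q then f (fst \<omega> / q, snd \<omega>) else g ((fst \<omega> - q) / (1 - q), snd \<omega>)) \<partial>input_law k p)
       = ennreal q * (\<integral>\<^sup>+\<omega>. f \<omega> \<partial>input_law k p) + ennreal (1 - q) * (\<integral>\<^sup>+\<omega>. g \<omega> \<partial>input_law k p)"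
proof -
  define U where "U = restrict_space lborel {0..1::real}"
  define X where "X = (\<Pi>\<^sub>M i\<in>{1..k}. \<Pi>\<^sub>M j\<in>{1::nat..}. measure_pmf (bernoulli_pmf (p i)))"
  interpret U: prob_space U unfolding U_def by (rule prob_space_restrict_space) auto
  interpret X: prob_space X unfolding X_def by (intro prob_space_PiM measure_pmf.prob_space_axioms)
  interpret UX: pair_sigma_finite U X ..
  have L: "input_law k p = U \<Otimes>\<^sub>M X" by (simp add: input_law_def U_def X_def)
  have sL: "sets (U \<Otimes>\<^sub>M X) = sets (inputs k)" using sets_input_law[of k p] L by simp
  have mL: "borel_measurable (inputs k) = borel_measurable (U \<Otimes>\<^sub>M X)" by (intro measurable_cong_sets sL[symmetric] refl)
  have f'[measurable]: "f \<in> borel_measurable (U \<Otimes>\<^sub>M X)" and g'[measurable]: "g \<in> borel_measurable (U \<Otimes>\<^sub>M X)"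
    using f g by (simp_all add: mL)
  have sU: "borel_measurable U = borel_measurable (restrict_space borel {0..1::real})"
    by (intro measurable_cong_sets refl) (simp add: U_def sets_restrict_space)
  have "(\<integral>\<^sup>+\<omega>. (if fst \<omega> < q then f (fst \<omega> / q, snd \<omega>) else g ((fst \<omega> - q) / (1 - q), snd \<omega>)) \<partial>(U \<Otimes>\<^sub>M X))
      = (\<integral>\<^sup>+x. (\<integral>\<^sup>+u. (if u < q then f (u / q, x) else g ((u - q) / (1 - q), x)) \<partial>U) \<partial>X)"
    using measurable_branch[OF q f g] unfolding mL by (subst UX.nn_integral_snd[symmetric]) (simp_all cong: if_cong)
  also have "\<dots> = (\<integral>\<^sup>+x. ennreal q * (\<integral>\<^sup>+u. f (u, x) \<partial>U) + ennreal (1 - q) * (\<integral>\<^sup>+u. g (u, x) \<partial>U) \<partial>X)"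
  proof (rule nn_integral_cong)
    fix x assume "x \<in> space X"
    then have "(\<lambda>u. f (u, x)) \<in> borel_measurable U" "(\<lambda>u. g (u, x)) \<in> borel_measurable U"
      by simp_all
    then show "(\<integral>\<^sup>+u. (if u < q then f (u / q, x) else g ((u - q) / (1 - q), x)) \<partial>U)
        = ennreal q * (\<integral>\<^sup>+u. f (u, x) \<partial>U) + ennreal (1 - q) * (\<integral>\<^sup>+u. g (u, x) \<partial>U)"
      unfolding sU unfolding U_def by (rule nn_integral_split_uniform[OF q])
  qed
  also have "\<dots> = ennreal q * (\<integral>\<^sup>+x. (\<integral>\<^sup>+u. f (u, x) \<partial>U) \<partial>X) + ennreal (1 - q) * (\<integral>\<^sup>+x. (\<integral>\<^sup>+u. g (u, x) \<partial>U) \<partial>X)"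
    by (simp add: nn_integral_add nn_integral_cmult)
  finally show ?thesis unfolding L by (simp add: UX.nn_integral_snd)
qed

lemma nn_integral_toss:
  assumes i: "i \<in> {1..k}" and p: "p i \<in> {0..1}"
    and f[measurable]: "\<And>b. f b \<in> borel_measurable (inputs k)"
  shows "(\<integral>\<^sup>+\<omega>. f (snd \<omega> i 1) (fst \<omega>, pop i (snd \<omega>)) \<partial>input_law k p)
       = ennreal (p i) * (\<integral>\<^sup>+\<omega>. f True \<omega> \<partial>input_law k p) + ennreal (1 - p i) * (\<integral>\<^sup>+\<omega>. f False \<omega> \<partial>input_law k p)"
proof -
  define U where "U = restrict_space lborel {0..1::real}"
  define X where "X = (\<Pi>\<^sub>M i\<in>{1..k}. \<Pi>\<^sub>M j\<in>{1::nat..}. measure_pmf (bernoulli_pmf (p i)))"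
  interpret U: prob_space U unfolding U_def by (rule prob_space_restrict_space) auto
  interpret X: prob_space X unfolding X_def by (intro prob_space_PiM measure_pmf.prob_space_axioms)
  interpret UX: pair_sigma_finite U X ..
  have L: "input_law k p = U \<Otimes>\<^sub>M X" by (simp add: input_law_def U_def X_def)
  have sL: "sets (U \<Otimes>\<^sub>M X) = sets (inputs k)" using sets_input_law[of k p] L by simp
  have mL: "borel_measurable (inputs k) = borel_measurable (U \<Otimes>\<^sub>M X)" by (intro measurable_cong_sets sL[symmetric] refl)
  have f'[measurable]: "f b \<in> borel_measurable (U \<Otimes>\<^sub>M X)" for b
    using f by (simp add: mL)
  have m: "(\<lambda>\<omega>. f (snd \<omega> i 1) (fst \<omega>, pop i (snd \<omega>))) \<in> borel_measurable (U \<Otimes>\<^sub>M X)"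
  proof -
    have "(\<lambda>\<omega>. f (snd \<omega> i 1) (fst \<omega>, pop i (snd \<omega>))) =
        (\<lambda>\<omega>. if snd \<omega> i 1 then f True (fst \<omega>, pop i (snd \<omega>)) else f False (fst \<omega>, pop i (snd \<omega>)))"
      by auto
    then show ?thesis using measurable_toss[OF i f f, of True False] by (simp add: mL)
  qed
  have sect: "(\<lambda>x. f b (u, x)) \<in> borel_measurable X" if "u \<in> space U" for b u
    using that by simp
  have "(\<integral>\<^sup>+\<omega>. f (snd \<omega> i 1) (fst \<omega>, pop i (snd \<omega>)) \<partial>(U \<Otimes>\<^sub>M X))
      = (\<integral>\<^sup>+u. (\<integral>\<^sup>+x. f (x i 1) (u, pop i x) \<partial>X) \<partial>U)"
    using m by (subst X.nn_integral_fst[symmetric]) simp_all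
  also have "\<dots> = (\<integral>\<^sup>+u. (\<integral>\<^sup>+b. (\<integral>\<^sup>+x. f b (u, x) \<partial>X) \<partial>bernoulli_pmf (p i)) \<partial>U)"
    unfolding X_def
    by (intro nn_integral_cong nn_integral_first_flip_of_coin[where B="\<lambda>i. measure_pmf (bernoulli_pmf (p i))"] i)
       (use sect[unfolded X_def] in \<open>auto simp: measure_pmf.prob_space_axioms\<close>)
  also have "\<dots> = (\<integral>\<^sup>+u. ennreal (p i) * (\<integral>\<^sup>+x. f True (u, x) \<partial>X) + ennreal (1 - p i) * (\<integral>\<^sup>+x. f False (u, x) \<partial>X) \<partial>U)"
    using p by (simp add: mult.commute)
  also have "\<dots> = ennreal (p i) * (\<integral>\<^sup>+u. (\<integral>\<^sup>+x. f True (u, x) \<partial>X) \<partial>U) + ennreal (1 - p i) * (\<integral>\<^sup>+u. (\<integral>\<^sup>+x. f False (u, x) \<partial>X) \<partial>U)"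
    by (simp add: nn_integral_add nn_integral_cmult)
  finally show ?thesis unfolding L by (simp add: X.nn_integral_fst)
qed

section \<open>Protocols\<close>

text \<open>A protocol is a function from states to actions.  \<open>Branch q s1 s2\<close> goes to \<open>s1\<close> with the known probability
  \<open>q\<close>, by looking at the uniform number, and \<open>Toss i s1 s2\<close> goes to \<open>s1\<close> if the next flip of coin \<open>i\<close> is heads.\<close>

datatype 's action = Halt bool | Branch real 's 's | Toss nat 's 's

text \<open>Randomness is removed from the input when it is used, so that a run after its first step is a run of the
  same protocol on a fresh input.\<close>

definition step :: "('s \<Rightarrow> 's action) \<Rightarrow> 's \<times> input \<Rightarrow> 's \<times> input" where
  "step act = (\<lambda>(s, \<omega>). case act s of
      Halt b \<Rightarrow> (s, \<omega>)
    | Branch q s1 s2 \<Rightarrow> if fst \<omega> < q then (s1, fst \<omega> / q, snd \<omega>) else (s2, (fst \<omega> - q) / (1 - q), snd \<omega>)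
    | Toss i s1 s2 \<Rightarrow> (if snd \<omega> i 1 then s1 else s2, fst \<omega>, pop i (snd \<omega>)))"

definition state_at :: "('s \<Rightarrow> 's action) \<Rightarrow> nat \<Rightarrow> 's \<times> input \<Rightarrow> 's" where
  "state_at act n c = fst ((step act ^^ n) c)"

definition halts_with :: "('s \<Rightarrow> 's action) \<Rightarrow> 's \<times> input \<Rightarrow> bool \<Rightarrow> bool" where
  "halts_with act c b \<longleftrightarrow> (\<exists>n. act (state_at act n c) = Halt b)"

definition legal :: "nat \<Rightarrow> ('s \<Rightarrow> 's action) \<Rightarrow> 's set \<Rightarrow> bool" where
  "legal k act S \<longleftrightarrow> (\<forall>s\<in>S. case act s of
      Halt b \<Rightarrow> True
    | Branch q s1 s2 \<Rightarrow> q \<in> {0..1} \<and> s1 \<in> S \<and> s2 \<in> S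
    | Toss i s1 s2 \<Rightarrow> i \<in> {1..k} \<and> s1 \<in> S \<and> s2 \<in> S)"

definition average :: "(nat \<Rightarrow> real) \<Rightarrow> ('s \<Rightarrow> 's action) \<Rightarrow> ('s \<Rightarrow> ennreal) \<Rightarrow> 's \<Rightarrow> ennreal" where
  "average p act F s = (case act s of
      Halt b \<Rightarrow> F s
    | Branch q s1 s2 \<Rightarrow> ennreal q * F s1 + ennreal (1 - q) * F s2
    | Toss i s1 s2 \<Rightarrow> ennreal (p i) * F s1 + ennreal (1 - p i) * F s2)"

definition accrued :: "('s \<Rightarrow> 's action) \<Rightarrow> ('s \<Rightarrow> 'a :: comm_monoid_add) \<Rightarrow> nat \<Rightarrow> 's \<times> input \<Rightarrow> 'a" where
  "accrued act \<pi> n c = (\<Sum>t<n. \<pi> (state_at act t c))"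

definition tossed :: "('s \<Rightarrow> 's action) \<Rightarrow> nat \<Rightarrow> 's \<Rightarrow> nat" where
  "tossed act i s = (case act s of Toss i' s1 s2 \<Rightarrow> of_bool (i' = i) | _ \<Rightarrow> 0)"

text \<open>A supremum in the extended naturals, since a run that does not halt may toss a coin infinitely often.\<close>

definition flips :: "('s \<Rightarrow> 's action) \<Rightarrow> 's \<Rightarrow> nat \<Rightarrow> input \<Rightarrow> enat" where
  "flips act s i \<omega> = (SUP n. enat (accrued act (tossed act i) n (s, \<omega>)))"

lemma state_at_0 [simp]: "state_at act 0 c = fst c"
  by (simp add: state_at_def)

lemma state_at_Suc: "state_at act (Suc n) c = state_at act n (step act c)"
  by (simp add: state_at_def funpow_swap1)

lemma accrued_0 [simp]: "accrued act \<pi> 0 c = 0"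
  by (simp add: accrued_def)

lemma accrued_Suc: "accrued act \<pi> (Suc n) c = \<pi> (fst c) + accrued act \<pi> n (step act c)"
  unfolding accrued_def by (simp only: sum.lessThan_Suc_shift state_at_0 state_at_Suc)

lemma legal_Branch:
  assumes "legal k act S" "s \<in> S" "act s = Branch q s1 s2"
  shows "0 \<le> q" "q \<le> 1" "s1 \<in> S" "s2 \<in> S"
  using bspec[OF assms(1)[unfolded legal_def] assms(2)] assms(3) by simp_all

lemma legal_Toss:
  assumes "legal k act S" "s \<in> S" "act s = Toss i s1 s2"
  shows "i \<in> {1..k}" "s1 \<in> S" "s2 \<in> S"
  using bspec[OF assms(1)[unfolded legal_def] assms(2)] assms(3) by simp_all

lemma step_in:
  assumes "legal k act S" "fst c \<in> S"
  shows "fst (step act c) \<in> S"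
  using legal_Branch[OF assms] legal_Toss[OF assms] assms(2)
  by (cases "act (fst c)") (simp_all add: step_def case_prod_beta)

lemma state_at_in: "legal k act S \<Longrightarrow> fst c \<in> S \<Longrightarrow> state_at act n c \<in> S"
  by (induction n arbitrary: c) (auto simp: state_at_Suc step_in)

lemma step_halted: "act (fst c) = Halt b \<Longrightarrow> step act c = c"
  by (auto simp: step_def split: prod.splits)

lemma state_at_mono:
  assumes "act (state_at act n c) = Halt b" "n \<le> n'"
  shows "state_at act n' c = state_at act n c"
  using assms(2)
proof (induction n' rule: dec_induct)
  case (step m)
  then show ?case using assms(1) by (simp add: state_at_def step_halted)
qed simp

lemma halts_with_unique:
  assumes "halts_with act c b" "halts_with act c b'"
  shows "b = b'"
proof -
  obtain n n' where "act (state_at act n c) = Halt b" "act (state_at act n' c) = Halt b'"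
    using assms by (auto simp: halts_with_def)
  then have "Halt b = act (state_at act (max n n') c)" "Halt b' = act (state_at act (max n n') c)"
    using state_at_mono[of act n c b "max n n'"] state_at_mono[of act n' c b' "max n n'"] by simp_all
  then show ?thesis by (metis action.inject(1))
qed

text \<open>Measurability is asked for the input only, separately for each state.  In this way no \<open>\<sigma>\<close>-algebra
  on the states is needed, whatever their number; it suffices to unfold runs at their first step.\<close>

lemma measurable_step:
  assumes S: "legal k act S" "s \<in> S"
    and F: "\<And>s. s \<in> S \<Longrightarrow> (\<lambda>\<omega>. F (s, \<omega>)) \<in> inputs k \<rightarrow>\<^sub>M N"
  shows "(\<lambda>\<omega>. F (step act (s, \<omega>))) \<in> inputs k \<rightarrow>\<^sub>M N"
proof (cases "act s")
  case (Halt b)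
  then show ?thesis using F[OF S(2)] by (simp add: step_def)
next
  case (Branch q s1 s2)
  note q = legal_Branch[OF S Branch]
  have "(\<lambda>\<omega>. F (step act (s, \<omega>))) =
      (\<lambda>\<omega>. if fst \<omega> < q then F (s1, (fst \<omega> / q, snd \<omega>)) else F (s2, ((fst \<omega> - q) / (1 - q), snd \<omega>)))"
    by (auto simp: step_def Branch)
  then show ?thesis using measurable_branch[OF q(1,2) F F, of s1 s2] q by simp
next
  case (Toss i s1 s2)
  note i = legal_Toss[OF S Toss]
  have "(\<lambda>\<omega>. F (step act (s, \<omega>))) =
      (\<lambda>\<omega>. if snd \<omega> i 1 then F (s1, (fst \<omega>, pop i (snd \<omega>))) else F (s2, (fst \<omega>, pop i (snd \<omega>))))"
    by (auto simp: step_def Toss)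
  then show ?thesis using measurable_toss[OF i(1) F F, of s1 s2] i by simp
qed

lemma measurable_iterate:
  assumes S: "legal k act S"
    and F: "\<And>s. s \<in> S \<Longrightarrow> (\<lambda>\<omega>. F (s, \<omega>)) \<in> inputs k \<rightarrow>\<^sub>M N"
  shows "s \<in> S \<Longrightarrow> (\<lambda>\<omega>. F ((step act ^^ n) (s, \<omega>))) \<in> inputs k \<rightarrow>\<^sub>M N"
proof (induction n arbitrary: s)
  case (Suc n)
  have "(\<lambda>\<omega>. F ((step act ^^ n) (step act (s, \<omega>)))) \<in> inputs k \<rightarrow>\<^sub>M N"
    using measurable_step[OF S Suc.prems, of "\<lambda>c. F ((step act ^^ n) c)"] Suc.IH by blast
  then show ?case by (simp add: funpow_swap1)
qed (use F in simp)

lemma measurable_state_at: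
  assumes "legal k act S" "s \<in> S"
  shows "(\<lambda>\<omega>. F (state_at act n (s, \<omega>))) \<in> inputs k \<rightarrow>\<^sub>M count_space UNIV"
  unfolding state_at_def using measurable_iterate[OF assms(1) _ assms(2), of "\<lambda>c. F (fst c)"] by simp

lemma measurable_halts_with:
  assumes "legal k act S" "s \<in> S"
  shows "Measurable.pred (inputs k) (\<lambda>\<omega>. halts_with act (s, \<omega>) b)"
proof -
  note [measurable] = measurable_state_at[OF assms, of "\<lambda>s. act s = Halt b"]
  show ?thesis unfolding halts_with_def by measurable
qed

lemma measurable_accrued:
  assumes "legal k act S" "s \<in> S"
  shows "(\<lambda>\<omega>. accrued act (\<pi> :: _ \<Rightarrow> ennreal) n (s, \<omega>)) \<in> borel_measurable (inputs k)"
proof -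
  have "(\<lambda>\<omega>. \<pi> (state_at act t (s, \<omega>))) \<in> borel_measurable (inputs k)" for t
    by (rule measurable_compose[OF measurable_state_at[OF assms, where F="\<lambda>s. s"]]) simp
  then show ?thesis unfolding accrued_def by measurable
qed

lemma measurable_flips:
  assumes "legal k act S" "s \<in> S"
  shows "flips act s i \<in> inputs k \<rightarrow>\<^sub>M count_space UNIV"
proof -
  note [measurable] = measurable_state_at[OF assms]
  show ?thesis unfolding flips_def[abs_def] accrued_def by measurable
qed

lemma nn_integral_step:
  assumes S: "legal k act S" "s \<in> S" and p: "\<And>i. i \<in> {1..k} \<Longrightarrow> p i \<in> {0..1}"
    and F: "\<And>s. s \<in> S \<Longrightarrow> (\<lambda>\<omega>. F (s, \<omega>)) \<in> borel_measurable (inputs k)"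
  shows "(\<integral>\<^sup>+\<omega>. F (step act (s, \<omega>)) \<partial>input_law k p) = average p act (\<lambda>s. \<integral>\<^sup>+\<omega>. F (s, \<omega>) \<partial>input_law k p) s"
proof (cases "act s")
  case (Halt b)
  then show ?thesis by (simp add: step_def average_def)
next
  case (Branch q s1 s2)
  note q = legal_Branch[OF S Branch]
  have "(\<lambda>\<omega>. F (step act (s, \<omega>))) =
      (\<lambda>\<omega>. if fst \<omega> < q then F (s1, (fst \<omega> / q, snd \<omega>)) else F (s2, ((fst \<omega> - q) / (1 - q), snd \<omega>)))"
    by (auto simp: step_def Branch)
  then show ?thesis using nn_integral_branch[OF q(1,2) F F, of s1 s2 p] q by (simp add: average_def Branch)
next
  case (Toss i s1 s2)
  note i = legal_Toss[OF S Toss]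
  then show ?thesis 
    using nn_integral_toss[of i k p "\<lambda>b \<omega>. F (if b then s1 else s2, \<omega>)"] Toss p F
    by (simp add: step_def average_def)
qed

lemma average_mono:
  assumes "legal k act S" "s \<in> S" "\<And>s. s \<in> S \<Longrightarrow> F s \<le> G s"
  shows "average p act F s \<le> average p act G s"
  using legal_Branch[OF assms(1,2)] legal_Toss[OF assms(1,2)] assms(2,3)
  by (cases "act s") (simp_all add: average_def add_mono mult_left_mono)

text \<open>The potential \<open>V\<close> pays for the price \<open>\<pi>\<close> of each action out of its expected decrease.  By induction on the
  length of the run, unfolded at its first step, the total price paid so far and the present potential
  together never exceed the initial potential on average.\<close>

lemma supersolution_bound:
  fixes V \<pi> :: "'s \<Rightarrow> ennreal"
  assumes S: "legal k act S" and p: "\<And>i. i \<in> {1..k} \<Longrightarrow> p i \<in> {0..1}"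
    and V: "\<And>s. s \<in> S \<Longrightarrow> \<pi> s + average p act V s \<le> V s"
  shows "s \<in> S \<Longrightarrow> (\<integral>\<^sup>+\<omega>. accrued act \<pi> n (s, \<omega>) + V (state_at act n (s, \<omega>)) \<partial>input_law k p) \<le> V s"
proof (induction n arbitrary: s)
  case 0
  interpret prob_space "input_law k p" by (rule prob_space_input_law)
  show ?case by (simp add: emeasure_space_1)
next
  case (Suc n)
  interpret prob_space "input_law k p" by (rule prob_space_input_law)
  define G where "G c = accrued act \<pi> n c + V (state_at act n c)" for c
  have G: "(\<lambda>\<omega>. G (s, \<omega>)) \<in> borel_measurable (inputs k)" if "s \<in> S" for s
  proof -
    have "(\<lambda>\<omega>. V (state_at act n (s, \<omega>))) \<in> borel_measurable (inputs k)"
      by (rule measurable_compose[OF measurable_state_at[OF S that, where F="\<lambda>s. s"]]) simp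
    then show ?thesis unfolding G_def using measurable_accrued[OF S that, of \<pi> n] by measurable
  qed
  have m: "borel_measurable (inputs k) = borel_measurable (input_law k p)"
    by (intro measurable_cong_sets sets_input_law[symmetric] refl)
  have "(\<integral>\<^sup>+\<omega>. accrued act \<pi> (Suc n) (s, \<omega>) + V (state_at act (Suc n) (s, \<omega>)) \<partial>input_law k p)
      = (\<integral>\<^sup>+\<omega>. \<pi> s + G (step act (s, \<omega>)) \<partial>input_law k p)"
    by (simp add: accrued_Suc state_at_Suc G_def add.assoc)
  also have "\<dots> = \<pi> s + (\<integral>\<^sup>+\<omega>. G (step act (s, \<omega>)) \<partial>input_law k p)"
    using measurable_step[OF S Suc.prems, of G, OF G] unfolding m
    by (subst nn_integral_add) (auto simp: emeasure_space_1)
  also have "\<dots> = \<pi> s + average p act (\<lambda>s. \<integral>\<^sup>+\<omega>. G (s, \<omega>) \<partial>input_law k p) s"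
    by (subst nn_integral_step[OF S Suc.prems p G]) auto
  also have "\<dots> \<le> \<pi> s + average p act V s"
    using Suc.IH by (intro add_left_mono average_mono[OF S Suc.prems]) (simp add: G_def)
  also have "\<dots> \<le> V s" by (rule V) fact
  finally show ?case .
qed

section \<open>Which flips a protocol has used\<close>

text \<open>Unfolding the first step, a toss of coin \<open>l\<close> uses up one of the \<open>t l\<close> flips on which the two inputs agree,
  and renumbering leaves agreement on the next \<open>t l - 1\<close> flips.\<close>

lemma state_at_agree:
  assumes S: "legal k act S"
  shows "s \<in> S \<Longrightarrow> (\<And>i. i \<in> {1..k} \<Longrightarrow> accrued act (tossed act i) n (s, u, x) \<le> t i) \<Longrightarrow>
     (\<And>i j. i \<in> {1..k} \<Longrightarrow> j \<in> {1..t i} \<Longrightarrow> x i j = x' i j) \<Longrightarrow> m \<le> n \<Longrightarrow>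
     state_at act m (s, u, x') = state_at act m (s, u, x)"
proof (induction m arbitrary: s u x x' t n)
  case (Suc m)
  then obtain n' where n: "n = Suc n'" "m \<le> n'" by (cases n) auto
  show ?case
  proof (cases "act s")
    case (Halt b)
    then show ?thesis using state_at_mono[of act 0 _ b "Suc m"] by (metis fst_conv state_at_0 zero_le)
  next
    case (Branch q s1 s2)
    have in_S: "fst (step act (s, u, x)) \<in> S" using step_in[OF S] Suc.prems by simp
    define s' u' where "s' = fst (step act (s, u, x))" and "u' = fst (snd (step act (s, u, x)))"
    have st: "step act (s, u, x) = (s', u', x)" "step act (s, u, x') = (s', u', x')"
      by (auto simp: s'_def u'_def step_def Branch)
    have "state_at act m (s', u', x') = state_at act m (s', u', x)"
    proof (rule Suc.IH[of s' n' u' x t])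
      show "accrued act (tossed act i) n' (s', u', x) \<le> t i" if "i \<in> {1..k}" for i
        using Suc.prems(2)[OF that] unfolding n accrued_Suc st by simp
    qed (use Suc.prems in_S n s'_def in auto)
    then show ?thesis by (simp add: state_at_Suc st)
  next
    case (Toss l s1 s2)
    have l: "l \<in> {1..k}" by (rule legal_Toss[OF S Suc.prems(1) Toss])
    have tl: "Suc (accrued act (tossed act l) n' (step act (s, u, x))) \<le> t l"
      using Suc.prems(2)[OF l] unfolding n accrued_Suc by (simp add: tossed_def Toss)
    then have eq: "x l 1 = x' l 1" using Suc.prems(3)[OF l, of 1] by simp
    define s' where "s' = (if x l 1 then s1 else s2)"
    have st: "step act (s, u, x) = (s', u, pop l x)" "step act (s, u, x') = (s', u, pop l x')"
      using eq by (auto simp: s'_def step_def Toss)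
    have "state_at act m (s', u, pop l x') = state_at act m (s', u, pop l x)"
    proof (rule Suc.IH[of s' n' u "pop l x" "t(l := t l - 1)"])
      show "s' \<in> S" using step_in[OF S, of "(s, u, x)"] Suc.prems(1) by (simp add: st)
      show "accrued act (tossed act i) n' (s', u, pop l x) \<le> (t(l := t l - 1)) i" if "i \<in> {1..k}" for i
        using Suc.prems(2)[OF that] tl unfolding n accrued_Suc st by auto
      show "pop l x i j = pop l x' i j" if "i \<in> {1..k}" "j \<in> {1..(t(l := t l - 1)) i}" for i j
        using Suc.prems(3)[OF that(1), of j] Suc.prems(3)[OF that(1), of "Suc j"] that
        by (auto simp: pop_def tails_def split: if_splits)
    qed (use n in auto)
    then show ?thesis by (simp add: state_at_Suc st)
  qed
qed simp

lemma observe_eqD: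
  assumes "observe k t (u, x) = observe k t (u', x')"
  shows "u = u'" and "i \<in> {1..k} \<Longrightarrow> j \<in> {1..t i} \<Longrightarrow> x i j = x' i j"
proof -
  show "u = u'" using assms by (simp add: observe_def)
  assume ij: "i \<in> {1..k}" "j \<in> {1..t i}"
  have "(\<lambda>i\<in>{1..k}. \<lambda>j\<in>{1..t i}. x i j) i j = (\<lambda>i\<in>{1..k}. \<lambda>j\<in>{1..t i}. x' i j) i j"
    using assms by (simp add: observe_def)
  then show "x i j = x' i j" using ij by simp
qed

lemma run_agree:
  assumes S: "legal k act S" "s \<in> S" and T: "\<And>i. i \<in> {1..k} \<Longrightarrow> flips act s i \<omega> = enat (t i)"
    and obs: "observe k t \<omega> = observe k t \<omega>'"
  shows "state_at act n (s, \<omega>') = state_at act n (s, \<omega>)"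
proof -
  obtain u x u' x' where w: "\<omega> = (u, x)" "\<omega>' = (u', x')" by (cases \<omega>, cases \<omega>')
  have "accrued act (tossed act i) n (s, u, x) \<le> t i" if "i \<in> {1..k}" for i n
  proof -
    have "enat (accrued act (tossed act i) n (s, u, x)) \<le> flips act s i \<omega>"
      unfolding flips_def w by (rule SUP_upper) simp
    then show ?thesis by (simp add: T[OF that])
  qed
  then have "state_at act n (s, u, x') = state_at act n (s, u, x)"
    using observe_eqD(2)[OF obs[unfolded w]] by (intro state_at_agree[OF S, of n u x t]) auto
  then show ?thesis using observe_eqD(1)[OF obs[unfolded w]] by (simp add: w)
qed

lemma flips_agree:
  assumes S: "legal k act S" "s \<in> S" and T: "\<And>i. i \<in> {1..k} \<Longrightarrow> flips act s i \<omega> = enat (t i)"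
    and obs: "observe k t \<omega> = observe k t \<omega>'"
  shows "flips act s i \<omega>' = flips act s i \<omega>"
  unfolding flips_def accrued_def using run_agree[OF assms] by simp

text \<open>The event that the numbers of flips are given by \<open>t\<close> has to be measurable with respect to the observed flips.
  It is the preimage, under observation, of the same event for inputs whose unobserved flips are all replaced
  by tails: by \<open>flips_agree\<close> the replacement does not affect the event.\<close>

lemma flip_counts_protocol:
  assumes S: "legal k act S" "s \<in> S"
  shows "flip_counts k (\<lambda>\<omega>. halts_with act (s, \<omega>) True) (flips act s)"
  unfolding flip_counts_def
proof (intro conjI ballI allI impI)
  show "flips act s i \<in> inputs k \<rightarrow>\<^sub>M count_space UNIV" for i
    by (rule measurable_flips[OF S])
next
  fix t :: "nat \<Rightarrow> nat" and \<omega> \<omega>' :: input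
  assume "\<forall>i\<in>{1..k}. flips act s i \<omega> = enat (t i)" "observe k t \<omega> = observe k t \<omega>'"
  then show "halts_with act (s, \<omega>) True = halts_with act (s, \<omega>') True"
    unfolding halts_with_def using run_agree[OF S, of \<omega> t \<omega>'] by simp
next
  fix t :: "nat \<Rightarrow> nat"
  define Ob where "Ob = restrict_space borel {0..1::real} \<Otimes>\<^sub>M (\<Pi>\<^sub>M i\<in>{1..k}. \<Pi>\<^sub>M j\<in>{1..t i}. count_space (UNIV :: bool set))"
  \<comment> \<open>Observed flips are kept, all others are set to tails.\<close>
  define ext :: "input \<Rightarrow> input" where
    "ext \<omega> = (fst \<omega>, \<lambda>i\<in>{1..k}. \<lambda>j\<in>{1..}. if j \<in> {1..t i} then snd \<omega> i j else False)" for \<omega>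
  define Q where "Q \<omega> \<longleftrightarrow> (\<forall>i\<in>{1..k}. flips act s i \<omega> = enat (t i))" for \<omega>
  have ext: "ext \<in> Ob \<rightarrow>\<^sub>M inputs k"
    unfolding Ob_def inputs_def ext_def[abs_def]
  proof (intro measurable_Pair measurable_fst measurable_restrict)
    fix i j assume i: "i \<in> {1..k}" and "j \<in> {1::nat..}"
    show "(\<lambda>\<omega>. if j \<in> {1..t i} then snd \<omega> i j else False) \<in>
      restrict_space borel {0..1::real} \<Otimes>\<^sub>M (\<Pi>\<^sub>M i\<in>{1..k}. \<Pi>\<^sub>M j\<in>{1..t i}. count_space UNIV) \<rightarrow>\<^sub>M count_space UNIV"
    proof (cases "j \<in> {1..t i}")
      case True
      have "(\<lambda>\<omega>. snd \<omega> i j) \<in>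
      restrict_space borel {0..1::real} \<Otimes>\<^sub>M (\<Pi>\<^sub>M i\<in>{1..k}. \<Pi>\<^sub>M j\<in>{1..t i}. count_space (UNIV :: bool set)) \<rightarrow>\<^sub>M count_space UNIV"
        by (rule measurable_compose[OF measurable_snd],
            rule measurable_compose[OF measurable_component_singleton[OF i], of _ "\<lambda>i. \<Pi>\<^sub>M j\<in>{1..t i}. count_space UNIV"])
           (rule measurable_component_singleton[OF True])
      then show ?thesis using True by simp
    qed auto
  qed
  have obs: "observe k t \<omega> \<in> space Ob" if "\<omega> \<in> space (inputs k)" for \<omega>
    using that by (auto simp: Ob_def space_inputs space_pair_measure space_PiM space_restrict_space observe_def)
  have eq: "observe k t (ext (observe k t \<omega>)) = observe k t \<omega>" for \<omega>
    by (auto simp: observe_def ext_def restrict_def fun_eq_iff split: prod.splits)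
  have Q_ext: "Q \<omega> \<longleftrightarrow> Q (ext (observe k t \<omega>))" for \<omega>
    unfolding Q_def
  proof safe
    fix i assume *: "\<forall>i\<in>{1..k}. flips act s i \<omega> = enat (t i)" and "i \<in> {1..k}"
    then show "flips act s i (ext (observe k t \<omega>)) = enat (t i)"
      using flips_agree[OF S, of \<omega> t "ext (observe k t \<omega>)"] eq by simp
  next
    fix i assume *: "\<forall>i\<in>{1..k}. flips act s i (ext (observe k t \<omega>)) = enat (t i)" and "i \<in> {1..k}"
    then show "flips act s i \<omega> = enat (t i)"
      using flips_agree[OF S, of "ext (observe k t \<omega>)" t \<omega>] eq by simp
  qed
  note [measurable] = measurable_flips[OF S] ext
  have "Measurable.pred (inputs k) Q" unfolding Q_def by measurable
  then have "{y \<in> space Ob. Q (ext y)} \<in> sets Ob"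
    using measurable_compose[OF ext, of Q "count_space UNIV"] by (simp add: pred_def)
  then have "observe k t -` {y \<in> space Ob. Q (ext y)} \<inter> space (inputs k) \<in> sets (observed k t)"
    unfolding observed_def Ob_def[symmetric] by (rule in_vimage_algebra)
  moreover have "observe k t -` {y \<in> space Ob. Q (ext y)} \<inter> space (inputs k) = {\<omega> \<in> space (inputs k). Q \<omega>}"
    using obs Q_ext by auto
  ultimately show "{\<omega> \<in> space (inputs k). \<forall>i\<in>{1..k}. flips act s i \<omega> = enat (t i)} \<in> sets (observed k t)"
    by (simp add: Q_def)
qed

section \<open>From protocols to factories\<close>

text \<open>A nonnegative function that does not increase on average and is at least 1 where the protocol halts with \<open>b\<close>
  dominates the probability of ever halting with \<open>b\<close>.\<close>

lemma halts_with_bound: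
  assumes S: "legal k act S" "s \<in> S" and p: "\<And>i. i \<in> {1..k} \<Longrightarrow> p i \<in> {0..1}"
    and h: "\<And>s. s \<in> S \<Longrightarrow> average p act h s \<le> h s" "\<And>s. s \<in> S \<Longrightarrow> act s = Halt b \<Longrightarrow> 1 \<le> h s"
  shows "emeasure (input_law k p) {\<omega> \<in> space (inputs k). halts_with act (s, \<omega>) b} \<le> h s"
proof -
  define E where "E n = {\<omega> \<in> space (inputs k). act (state_at act n (s, \<omega>)) = Halt b}" for n
  have E: "E n \<in> sets (input_law k p)" for n
    using measurable_state_at[OF S, of "\<lambda>s. act s = Halt b" n] unfolding E_def sets_input_law
    by (simp add: pred_def)
  have "emeasure (input_law k p) (E n) \<le> h s" for n
  proof -
    have "emeasure (input_law k p) (E n) = (\<integral>\<^sup>+\<omega>. indicator (E n) \<omega> \<partial>input_law k p)"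
      using E by simp
    also have "\<dots> \<le> (\<integral>\<^sup>+\<omega>. accrued act (\<lambda>_. 0) n (s, \<omega>) + h (state_at act n (s, \<omega>)) \<partial>input_law k p)"
      using h(2)[OF state_at_in[OF S(1)]] S(2)
      by (intro nn_integral_mono) (auto simp: indicator_def E_def accrued_def)
    also have "\<dots> \<le> h s"
      by (rule supersolution_bound[OF S(1) p _ S(2)]) (simp_all add: h)
    finally show ?thesis .
  qed
  then have "(SUP n. emeasure (input_law k p) (E n)) \<le> h s" by (rule SUP_least)
  moreover have "(SUP n. emeasure (input_law k p) (E n)) = emeasure (input_law k p) (\<Union>n. E n)"
  proof (rule SUP_emeasure_incseq)
    show "incseq E"
      unfolding incseq_def
    proof (intro allI impI subsetI)
      fix n n' \<omega> assume le: "n \<le> n'" and w: "\<omega> \<in> E n"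
      then have "act (state_at act n (s, \<omega>)) = Halt b" by (simp add: E_def)
      from state_at_mono[where act=act, OF this le] this w show "\<omega> \<in> E n'" by (simp add: E_def)
    qed
  qed (use E in auto)
  moreover have "(\<Union>n. E n) = {\<omega> \<in> space (inputs k). halts_with act (s, \<omega>) b}"
    by (auto simp: E_def halts_with_def)
  ultimately show ?thesis by simp
qed

text \<open>With price 1 for every action before halting the total price is the number of steps, so a finite
  potential makes an infinite run a null event.\<close>

lemma AE_halts:
  assumes S: "legal k act S" "s \<in> S" and p: "\<And>i. i \<in> {1..k} \<Longrightarrow> p i \<in> {0..1}"
    and W: "\<And>s. s \<in> S \<Longrightarrow> (if \<exists>b. act s = Halt b then 0 else 1) + average p act W s \<le> W s" "W s < \<infinity>"
  shows "AE \<omega> in input_law k p. \<exists>b. halts_with act (s, \<omega>) b"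
proof -
  define N where "N = {\<omega> \<in> space (inputs k). \<not> (\<exists>b. halts_with act (s, \<omega>) b)}"
  note [measurable] = measurable_halts_with[OF S]
  have N: "N \<in> sets (input_law k p)" unfolding N_def sets_input_law by measurable
  define \<pi> :: "_ \<Rightarrow> ennreal" where "\<pi> s = (if \<exists>b. act s = Halt b then 0 else 1)" for s
  have bd: "of_nat n * emeasure (input_law k p) N \<le> W s" for n
  proof -
    have "of_nat n * emeasure (input_law k p) N = (\<integral>\<^sup>+\<omega>. of_nat n * indicator N \<omega> \<partial>input_law k p)"
      using N by (simp add: nn_integral_cmult)
    also have "\<dots> \<le> (\<integral>\<^sup>+\<omega>. accrued act \<pi> n (s, \<omega>) + W (state_at act n (s, \<omega>)) \<partial>input_law k p)"
    proof (rule nn_integral_mono)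
      fix \<omega>
      have "accrued act \<pi> n (s, \<omega>) = of_nat n" if "\<omega> \<in> N"
        using that by (simp add: accrued_def N_def halts_with_def \<pi>_def)
      then show "of_nat n * indicator N \<omega> \<le> accrued act \<pi> n (s, \<omega>) + W (state_at act n (s, \<omega>))"
        by (auto simp: indicator_def)
    qed
    also have "\<dots> \<le> W s"
      by (rule supersolution_bound[OF S(1) p _ S(2)]) (simp_all add: W \<pi>_def)
    finally show ?thesis .
  qed
  have "emeasure (input_law k p) N = 0"
  proof (rule ccontr)
    assume "emeasure (input_law k p) N \<noteq> 0"
    then have "(SUP n. of_nat n * emeasure (input_law k p) N) = \<infinity>"
      by (simp add: SUP_mult_right_ennreal[symmetric] ennreal_SUP_of_nat_eq_top ennreal_top_mult)
    moreover have "(SUP n. of_nat n * emeasure (input_law k p) N) \<le> W s" by (rule SUP_least) (rule bd)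
    ultimately have "\<infinity> \<le> W s" by (simp only:)
    then show False using W(2) by (simp add: top.extremum_unique)
  qed
  then show ?thesis using N by (intro AE_I[where N=N]) (auto simp: N_def space_input_law)
qed

lemma expected_flips_bound:
  assumes S: "legal k act S" "s \<in> S" and p: "\<And>i. i \<in> {1..k} \<Longrightarrow> p i \<in> {0..1}"
    and V: "\<And>s. s \<in> S \<Longrightarrow> (case act s of Toss i s1 s2 \<Rightarrow> 1 | _ \<Rightarrow> 0) + average p act V s \<le> V s"
  shows "expected_flips k p (flips act s) \<le> V s"
proof -
  define \<pi> :: "_ \<Rightarrow> ennreal" where "\<pi> s = (case act s of Toss i s1 s2 \<Rightarrow> 1 | _ \<Rightarrow> 0)" for s
  define G where "G n \<omega> = accrued act \<pi> n (s, \<omega>)" for n \<omega>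
  have \<pi>: "(\<Sum>i=1..k. of_nat (tossed act i s)) = \<pi> s" if "s \<in> S" for s
    using legal_Toss(1)[OF S(1) that] by (cases "act s") (simp_all add: tossed_def \<pi>_def of_bool_def if_distrib cong: if_cong)
  have sum: "(\<Sum>i=1..k. of_nat (accrued act (tossed act i) n (s, \<omega>))) = G n \<omega>" for n \<omega>
    unfolding accrued_def G_def of_nat_sum
    by (subst sum.swap) (intro sum.cong refl \<pi> state_at_in[OF S(1)], simp add: S(2))
  have "(\<Sum>i=1..k. ennreal_of_enat (flips act s i \<omega>)) = (SUP n. G n \<omega>)" for \<omega>
  proof -
    have "(\<Sum>i=1..k. ennreal_of_enat (flips act s i \<omega>))
        = (\<Sum>i=1..k. SUP n. of_nat (accrued act (tossed act i) n (s, \<omega>)))"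
      unfolding flips_def by (simp add: ennreal_of_enat_Sup image_comp)
    also have "\<dots> = (SUP n. \<Sum>i=1..k. of_nat (accrued act (tossed act i) n (s, \<omega>)))"
      by (intro ennreal_SUP_sum[symmetric] incseq_SucI) (simp add: accrued_def)
    finally show ?thesis by (simp only: sum)
  qed
  then have "expected_flips k p (flips act s) = (\<integral>\<^sup>+\<omega>. (SUP n. G n \<omega>) \<partial>input_law k p)"
    by (simp add: expected_flips_def)
  also have "\<dots> = (SUP n. \<integral>\<^sup>+\<omega>. G n \<omega> \<partial>input_law k p)"
  proof (rule nn_integral_monotone_convergence_SUP)
    show "incseq G" by (intro incseq_SucI le_funI) (simp add: G_def accrued_def)
    show "G n \<in> borel_measurable (input_law k p)" for n
      using measurable_accrued[OF S, of \<pi> n] unfolding G_def[abs_def]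
      by (simp add: measurable_cong_sets[OF sets_input_law refl])
  qed
  also have "\<dots> \<le> V s"
  proof (rule SUP_least)
    fix n
    have "(\<integral>\<^sup>+\<omega>. G n \<omega> \<partial>input_law k p) \<le> (\<integral>\<^sup>+\<omega>. accrued act \<pi> n (s, \<omega>) + V (state_at act n (s, \<omega>)) \<partial>input_law k p)"
      by (intro nn_integral_mono) (simp add: G_def)
    also have "\<dots> \<le> V s"
      by (rule supersolution_bound[OF S(1) p _ S(2)]) (simp_all add: V \<pi>_def)
    finally show "(\<integral>\<^sup>+\<omega>. G n \<omega> \<partial>input_law k p) \<le> V s" .
  qed
  finally show ?thesis .
qed

lemma flips_finite:
  assumes "halts_with act (s, \<omega>) b"
  shows "flips act s i \<omega> < \<infinity>"
proof -
  obtain N where N: "act (state_at act N (s, \<omega>)) = Halt b" using assms by (auto simp: halts_with_def)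
  have "accrued act (tossed act i) n (s, \<omega>) \<le> accrued act (tossed act i) N (s, \<omega>)" for n
  proof (cases "n \<le> N")
    case True
    then show ?thesis unfolding accrued_def by (intro sum_mono2) auto
  next
    case False
    then have "accrued act (tossed act i) n (s, \<omega>) = accrued act (tossed act i) N (s, \<omega>) + (\<Sum>t=N..<n. tossed act i (state_at act t (s, \<omega>)))"
      unfolding accrued_def by (simp add: sum.atLeastLessThan_concat lessThan_atLeast0)
    also have "(\<Sum>t=N..<n. tossed act i (state_at act t (s, \<omega>))) = 0"
    proof (intro sum.neutral ballI)
      fix t assume "t \<in> {N..<n}"
      then have "state_at act t (s, \<omega>) = state_at act N (s, \<omega>)"
        by (intro state_at_mono[where act=act, OF N]) simp
      then show "tossed act i (state_at act t (s, \<omega>)) = 0" by (simp only: tossed_def N) simp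
    qed
    finally show ?thesis by simp
  qed
  then have "flips act s i \<omega> \<le> enat (accrued act (tossed act i) N (s, \<omega>))"
    unfolding flips_def by (intro SUP_least) simp
  then show ?thesis by (rule order.strict_trans1) simp
qed

text \<open>Only upper bounds are required for the probabilities of the two outputs.  They add up to 1, as do the
  probabilities themselves because of almost sure halting, hence both bounds are attained.\<close>

theorem protocol_factory:
  assumes S: "legal k act S" "s \<in> S"
    and D: "D \<subseteq> {1..k} \<rightarrow>\<^sub>E {0..1}" and f: "f \<in> D \<rightarrow> {0..1}" "computable_fun k cs D f"
    and prog: "\<And>\<omega> v. \<omega> \<in> space (inputs k) \<Longrightarrow> runs_to k cs c \<omega> v \<longleftrightarrow> (\<exists>b. halts_with act (s, \<omega>) b \<and> v = of_bool b)"
    and h: "\<And>p b s. p \<in> D \<Longrightarrow> s \<in> S \<Longrightarrow> average p act (h p b) s \<le> h p b s"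
      "\<And>p b s. p \<in> D \<Longrightarrow> s \<in> S \<Longrightarrow> act s = Halt b \<Longrightarrow> 1 \<le> h p b s"
      "\<And>p. p \<in> D \<Longrightarrow> h p True s \<le> ennreal (f p)" "\<And>p. p \<in> D \<Longrightarrow> h p False s \<le> ennreal (1 - f p)"
    and W: "\<And>p s. p \<in> D \<Longrightarrow> s \<in> S \<Longrightarrow> (if \<exists>b. act s = Halt b then 0 else 1) + average p act (W p) s \<le> W p s"
      "\<And>p. p \<in> D \<Longrightarrow> W p s < \<infinity>"
  shows "multivariate_bernoulli_factory k cs D f (\<lambda>\<omega>. halts_with act (s, \<omega>) True) (flips act s)"
proof -
  define A where "A \<omega> = halts_with act (s, \<omega>) True" for \<omega>
  have p: "p i \<in> {0..1}" if "p \<in> D" "i \<in> {1..k}" for p i using D that by (auto simp: PiE_iff)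
  have A: "A \<in> inputs k \<rightarrow>\<^sub>M count_space UNIV"
    unfolding A_def[abs_def] by (rule measurable_halts_with[OF S])
  have halts: "AE \<omega> in input_law k p. \<exists>b. halts_with act (s, \<omega>) b" if "p \<in> D" for p
    by (rule AE_halts[where p=p and W="W p", OF S p[OF that] W[OF that]])
  have law: "distr (input_law k p) (count_space UNIV) A = measure_pmf (bernoulli_pmf (f p))" if pD: "p \<in> D" for p
  proof -
    interpret L: prob_space "input_law k p" by (rule prob_space_input_law)
    have A': "A \<in> input_law k p \<rightarrow>\<^sub>M count_space UNIV"
      using A by (simp add: measurable_cong_sets[OF sets_input_law refl])
    have fp: "0 \<le> f p" "f p \<le> 1" using f(1) pD by auto
    have m: "emeasure (distr (input_law k p) (count_space UNIV) A) X
        = emeasure (input_law k p) {\<omega> \<in> space (inputs k). A \<omega> \<in> X}" for X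
      using A' by (subst emeasure_distr) (auto simp: space_input_law intro!: arg_cong[where f="emeasure _"])
    have T: "emeasure (input_law k p) {\<omega> \<in> space (inputs k). A \<omega>} \<le> ennreal (f p)"
      unfolding A_def
      by (rule order_trans[OF _ h(3)[OF pD]], rule halts_with_bound[where p=p, OF S p[OF pD]])
         (assumption, rule h(1)[OF pD], assumption, rule h(2)[OF pD], assumption+)
    have F: "emeasure (input_law k p) {\<omega> \<in> space (inputs k). \<not> A \<omega>} \<le> ennreal (1 - f p)"
    proof -
      have "emeasure (input_law k p) {\<omega> \<in> space (inputs k). \<not> A \<omega>}
         = emeasure (input_law k p) {\<omega> \<in> space (inputs k). halts_with act (s, \<omega>) False}"
      proof (rule emeasure_eq_AE)
        show "AE \<omega> in input_law k p. (\<omega> \<in> {\<omega> \<in> space (inputs k). \<not> A \<omega>}) = (\<omega> \<in> {\<omega> \<in> space (inputs k). halts_with act (s, \<omega>) False})"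
          using halts[OF pD]
        proof eventually_elim
          case (elim \<omega>)
          then have "\<not> A \<omega> \<longleftrightarrow> halts_with act (s, \<omega>) False"
            unfolding A_def using halts_with_unique[where act=act] by (metis (full_types))
          then show ?case by blast
        qed
      qed (use measurable_halts_with[OF S] in \<open>auto simp: A_def sets_input_law pred_def\<close>)
      also have "\<dots> \<le> h p False s"
        by (rule halts_with_bound[where p=p, OF S p[OF pD]])
           (assumption, rule h(1)[OF pD], assumption, rule h(2)[OF pD], assumption+)
      also note h(4)[OF pD]
      finally show ?thesis .
    qed
    define a where "a = measure (input_law k p) {\<omega> \<in> space (inputs k). A \<omega>}"
    have sT: "{\<omega> \<in> space (inputs k). A \<omega>} \<in> L.events"
      using A by (auto simp: sets_input_law pred_def)
    have "L.prob (space (input_law k p) - {\<omega> \<in> space (inputs k). A \<omega>}) = 1 - a"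
      unfolding a_def by (rule L.prob_compl[OF sT])
    moreover have "space (input_law k p) - {\<omega> \<in> space (inputs k). A \<omega>} = {\<omega> \<in> space (inputs k). \<not> A \<omega>}"
      by (auto simp: space_input_law)
    ultimately have b: "measure (input_law k p) {\<omega> \<in> space (inputs k). \<not> A \<omega>} = 1 - a" by simp
    have "a \<le> f p" "1 - a \<le> 1 - f p"
      using T F fp b by (simp_all add: L.emeasure_eq_measure a_def[symmetric])
    then have a: "a = f p" by simp
    show ?thesis
    proof (rule measure_eqI_countable[where A=UNIV])
      fix v :: bool
      show "emeasure (distr (input_law k p) (count_space UNIV) A) {v} = emeasure (measure_pmf (bernoulli_pmf (f p))) {v}"
        using b fp by (cases v) (simp_all add: m L.emeasure_eq_measure a[symmetric] a_def[symmetric] emeasure_pmf_single)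
    qed auto
  qed
  have "computable_factory k cs D A"
    unfolding computable_factory_def
  proof (intro exI[of _ c] conjI ballI allI impI)
    fix \<omega> v assume "\<omega> \<in> space (inputs k)" "runs_to k cs c \<omega> v"
    then obtain b where "halts_with act (s, \<omega>) b" "v = of_bool b" using prog by auto
    then show "v = of_bool (A \<omega>)" using halts_with_unique[of act "(s, \<omega>)" b True] unfolding A_def by (cases b) auto
  next
    fix p assume "p \<in> D"
    from halts[OF this] AE_space show "AE \<omega> in input_law k p. \<exists>v. runs_to k cs c \<omega> v"
      by eventually_elim (use prog in \<open>auto simp: space_input_law\<close>)
  qed
  moreover have "AE \<omega> in input_law k p. \<forall>i\<in>{1..k}. flips act s i \<omega> < \<infinity>" if "p \<in> D" for p
    using halts[OF that] by eventually_elim (blast intro: flips_finite[where act=act])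
  ultimately show ?thesis
    using D f A law flip_counts_protocol[OF S]
    unfolding multivariate_bernoulli_factory_def A_def[abs_def, symmetric] by blast
qed

section \<open>Programs that run protocols\<close>

inductive_cases exec_StoreE: "exec x (Store a e) s s'"
inductive_cases exec_FlipE: "exec x (Flip a e) s s'"
inductive_cases exec_SeqE: "exec x (Seq c d) s s'"
inductive_cases exec_CondE: "exec x (Cond b c d) s s'"
inductive_cases exec_WhileE: "exec x (While b c) s s'"

lemma exec_deterministic:
  "exec x c s s' \<Longrightarrow> exec x c s s'' \<Longrightarrow> s'' = s'"
proof (induction arbitrary: s'' rule: exec.induct)
  case (store a e m n) then show ?case by (auto elim: exec_StoreE)
next
  case (flip i e m a n) then show ?case by (auto elim: exec_FlipE)
next
  case (seq c s s' d s'a) then show ?case by (blast elim: exec_SeqE)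
next
  case (if_true b s c s' d) then show ?case by (blast elim: exec_CondE)
next
  case (if_false b s d s' c) then show ?case by (blast elim: exec_CondE)
next
  case (while_true b s c s' s'a)
  from while_true.prems show ?case
    by (rule exec_WhileE) (use while_true in blast)+
next
  case (while_false b s c)
  from while_false.prems show ?case
    by (rule exec_WhileE) (use while_false in blast)+
qed

text \<open>The relation \<open>R s u m\<close> says that the memory \<open>m\<close> represents the state \<open>s\<close> together with the unused uniform
  number \<open>u\<close>.  One iteration of the loop with test \<open>b\<close> and body \<open>c\<close> performs one action.\<close>

definition simulates ::
  "('s \<Rightarrow> real \<Rightarrow> (nat \<Rightarrow> real) \<Rightarrow> bool) \<Rightarrow> ('s \<Rightarrow> 's action) \<Rightarrow> 's set \<Rightarrow> test \<Rightarrow> prog \<Rightarrow> bool" where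
  "simulates R act S b c \<longleftrightarrow> (\<forall>s\<in>S. \<forall>u m. R s u m \<longrightarrow>
     (case act s of
        Halt v \<Rightarrow> \<not> holds b m \<and> m 0 = of_bool v
      | Branch q s1 s2 \<Rightarrow> holds b m \<and> (\<exists>m'. (\<forall>x n. exec x c (m, n) (m', n)) \<and>
          (if u < q then R s1 (u / q) m' else R s2 ((u - q) / (1 - q)) m'))
      | Toss i s1 s2 \<Rightarrow> holds b m \<and> (\<forall>x n. \<exists>m'. exec x c (m, n) (m', n(i := Suc (n i))) \<and>
          R (if x i (Suc (n i)) then s1 else s2) u m')))"

text \<open>Programs count the flips they have used and keep the flips as they are, whereas protocols renumber the
  remaining flips; \<open>x'\<close> is what remains of \<open>x\<close> after the first \<open>n i\<close> flips of each coin \<open>i\<close>.\<close>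

definition unread :: "(nat \<Rightarrow> nat \<Rightarrow> bool) \<Rightarrow> (nat \<Rightarrow> nat) \<Rightarrow> nat \<Rightarrow> (nat \<Rightarrow> nat \<Rightarrow> bool) \<Rightarrow> bool" where
  "unread x n k x' \<longleftrightarrow> (\<forall>i\<in>{1..k}. \<forall>j\<ge>1. x' i j = x i (n i + j))"

lemma simulates_step:
  assumes sim: "simulates R act S b c" and S: "legal k act S" "s \<in> S"
    and R: "R s u m" and x': "unread x n k x'" and nh: "\<And>v. act s \<noteq> Halt v"
  obtains s' u' x'' m' n' where "holds b m" "step act (s, u, x') = (s', u', x'')"
    "exec x c (m, n) (m', n')" "R s' u' m'" "unread x n' k x''" "s' \<in> S"
proof (cases "act s")
  case (Halt v)
  then show ?thesis using nh by blast
next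
  case (Branch q s1 s2)
  with bspec[OF sim[unfolded simulates_def] S(2)] R obtain m' where
    "holds b m" "exec x c (m, n) (m', n)" "if u < q then R s1 (u / q) m' else R s2 ((u - q) / (1 - q)) m'"
    by fastforce
  with legal_Branch[OF S Branch] x' that[of "if u < q then s1 else s2" "if u < q then u / q else (u - q) / (1 - q)" x' m' n]
  show ?thesis by (simp add: step_def Branch split: if_splits)
next
  case (Toss i s1 s2)
  note i = legal_Toss[OF S Toss]
  from Toss bspec[OF sim[unfolded simulates_def] S(2)] R obtain m' where
    "holds b m" "exec x c (m, n) (m', n(i := Suc (n i)))" "R (if x i (Suc (n i)) then s1 else s2) u m'"
    by fastforce
  moreover have "x' i 1 = x i (Suc (n i))" using x' i by (simp add: unread_def)
  moreover have "unread x (n(i := Suc (n i))) k (pop i x')"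
    using x' i by (auto simp: unread_def pop_def tails_def)
  ultimately show ?thesis using i
    by (intro that[of "if x' i 1 then s1 else s2" u "pop i x'" m' "n(i := Suc (n i))"]) (auto simp: step_def Toss)
qed

lemma simulation_complete:
  assumes sim: "simulates R act S b c" and S: "legal k act S"
  shows "s \<in> S \<Longrightarrow> R s u m \<Longrightarrow> unread x n k x' \<Longrightarrow> act (state_at act N (s, u, x')) = Halt v \<Longrightarrow>
    \<exists>m' n'. exec x (While b c) (m, n) (m', n') \<and> m' 0 = of_bool v"
proof (induction N arbitrary: s u m n x')
  case 0
  then have "\<not> holds b m" "m 0 = of_bool v"
    using bspec[OF sim[unfolded simulates_def] 0(1)] by auto
  then show ?case using while_false[of b "(m, n)" x c] by auto
next
  case (Suc N)
  show ?case
  proof (cases "\<exists>v. act s = Halt v")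
    case True
    then obtain w where w: "act s = Halt w" ..
    then have "w = v" using state_at_mono[of act 0 "(s, u, x')" w "Suc N"] Suc.prems(4) by simp
    then have "\<not> holds b m" "m 0 = of_bool v"
      using bspec[OF sim[unfolded simulates_def] Suc.prems(1)] Suc.prems(2) w by auto
    then show ?thesis using while_false[of b "(m, n)" x c] by auto
  next
    case False
    then have nh: "\<And>v. act s \<noteq> Halt v" by blast
    obtain s' u' x'' m' n' where st: "holds b m" "step act (s, u, x') = (s', u', x'')"
      "exec x c (m, n) (m', n')" "R s' u' m'" "unread x n' k x''" "s' \<in> S"
      by (rule simulates_step[where act=act, OF sim S Suc.prems(1-3) nh])
    with Suc.prems(4) have "act (state_at act N (s', u', x'')) = Halt v" by (simp add: state_at_Suc)
    from Suc.IH[OF st(6,4,5) this] obtain m'' n'' where "exec x (While b c) (m', n') (m'', n'')" "m'' 0 = of_bool v"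
      by blast
    with st(1,3) show ?thesis using while_true[of b "(m, n)" x c] by fastforce
  qed
qed

text \<open>Programs are deterministic, so a terminating execution of the loop has to follow the simulation, and
  it can only leave the loop in a state in which the protocol has halted.\<close>

lemma simulation_sound:
  assumes sim: "simulates R act S b c" and S: "legal k act S"
  shows "exec x w st fin \<Longrightarrow> w = While b c \<Longrightarrow> st = (m, n) \<Longrightarrow> s \<in> S \<Longrightarrow> R s u m \<Longrightarrow> unread x n k x' \<Longrightarrow>
    \<exists>v. halts_with act (s, u, x') v"
proof (induction arbitrary: m n s u x' rule: exec.induct)
  case (while_true b' st c' st' st'')
  show ?case
  proof (cases "\<exists>v. act s = Halt v")
    case True
    then obtain v where "act s = Halt v" ..
    then have "halts_with act (s, u, x') v" unfolding halts_with_def by (intro exI[of _ 0]) simp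
    then show ?thesis ..
  next
    case False
    then have nh: "\<And>v. act s \<noteq> Halt v" by blast
    obtain s' u' x'' m' n' where st: "holds b m" "step act (s, u, x') = (s', u', x'')"
      "exec x c (m, n) (m', n')" "R s' u' m'" "unread x n' k x''" "s' \<in> S"
      by (rule simulates_step[where act=act, OF sim S while_true.prems(3-5) nh])
    have "st' = (m', n')" using exec_deterministic[OF st(3)] while_true by auto
    from while_true.IH(2)[OF while_true.prems(1) this st(6,4,5)] obtain v N where
      "act (state_at act N (s', u', x'')) = Halt v" unfolding halts_with_def by blast
    then have "act (state_at act (Suc N) (s, u, x')) = Halt v" by (simp add: state_at_Suc st(2))
    then show ?thesis unfolding halts_with_def by blast
  qed
next
  case (while_false b' st c')
  then have "\<not> holds b m" by simp
  then obtain v where "act s = Halt v"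
    using bspec[OF sim[unfolded simulates_def] while_false.prems(3)] while_false.prems(4)
    by (cases "act s") auto
  then have "halts_with act (s, u, x') v" unfolding halts_with_def by (intro exI[of _ 0]) simp
  then show ?case ..
qed auto

lemma runs_to_iff_halts_with:
  assumes sim: "simulates R act S b c" and S: "legal k act S" "s \<in> S"
    and start: "\<And>x. exec x d (init (fst \<omega> # cs)) (m, \<lambda>_. 0)" "R s (fst \<omega>) m"
  shows "runs_to k cs (Seq d (While b c)) \<omega> v \<longleftrightarrow> (\<exists>r. halts_with act (s, \<omega>) r \<and> v = of_bool r)"
proof -
  define x where "x i j \<longleftrightarrow> i \<in> {1..k} \<and> snd \<omega> i j" for i j
  have un: "unread x (\<lambda>_. 0) k (snd \<omega>)" by (auto simp: unread_def x_def)
  have x_eq: "(\<lambda>i j. i \<in> {1..k} \<and> snd \<omega> i j) = x" by (simp add: x_def fun_eq_iff)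
  have complete: "\<exists>m' n'. exec x (Seq d (While b c)) (init (fst \<omega> # cs)) (m', n') \<and> m' 0 = of_bool r"
    if "halts_with act (s, \<omega>) r" for r
    using that simulation_complete[OF sim S(1) S(2) start(2) un] seq[OF start(1)] 
    unfolding halts_with_def by fastforce
  have sound: "\<exists>r. halts_with act (s, \<omega>) r" if "exec x (Seq d (While b c)) (init (fst \<omega> # cs)) fin" for fin
  proof -
    from that obtain st where "exec x d (init (fst \<omega> # cs)) st" "exec x (While b c) st fin"
      by (rule exec_SeqE)
    with exec_deterministic[OF start(1)] have "exec x (While b c) (m, \<lambda>_. 0) fin" by auto
    from simulation_sound[OF sim S(1) this refl refl S(2) start(2) un] show ?thesis by simp
  qed
  show ?thesis
  proof
    assume "runs_to k cs (Seq d (While b c)) \<omega> v"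
    then obtain m' n' where fin: "exec x (Seq d (While b c)) (init (fst \<omega> # cs)) (m', n')" "m' 0 = v"
      unfolding runs_to_def outputs_def x_eq by blast
    from sound[OF fin(1)] obtain r where r: "halts_with act (s, \<omega>) r" ..
    from complete[OF r] exec_deterministic[OF fin(1)] fin(2) have "v = of_bool r" by auto
    with r show "\<exists>r. halts_with act (s, \<omega>) r \<and> v = of_bool r" by blast
  next
    assume "\<exists>r. halts_with act (s, \<omega>) r \<and> v = of_bool r"
    with complete show "runs_to k cs (Seq d (While b c)) \<omega> v"
      unfolding runs_to_def outputs_def x_eq by blast
  qed
qed

text \<open>The result of programs without loops and flips; on the other programs the value is arbitrary.\<close>

primrec effect :: "prog \<Rightarrow> (nat \<Rightarrow> real) \<Rightarrow> nat \<Rightarrow> real" where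
  "effect (Store a e) m = m(addr (val a m) := val e m)"
| "effect (Flip a e) m = m"
| "effect (Seq c d) m = effect d (effect c m)"
| "effect (Cond b c d) m = (if holds b m then effect c m else effect d m)"
| "effect (While b c) m = m"

primrec straight :: "prog \<Rightarrow> bool" where
  "straight (Store a e) \<longleftrightarrow> True"
| "straight (Flip a e) \<longleftrightarrow> False"
| "straight (Seq c d) \<longleftrightarrow> straight c \<and> straight d"
| "straight (Cond b c d) \<longleftrightarrow> straight c \<and> straight d"
| "straight (While b c) \<longleftrightarrow> False"

lemma exec_straight: "straight c \<Longrightarrow> exec x c (m, n) (effect c m, n)"
proof (induction c arbitrary: m)
  case (Store a e) show ?case using exec.store[of x a e m n] by (simp add: fun_upd_def)
next
  case (Seq c d) then show ?case by (auto intro: exec.seq)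
next
  case (Cond b c d) then show ?case by (auto intro: exec.if_true exec.if_false)
qed auto

lemma addr_of_nat [simp]: "addr (real n) = n"
  by (simp add: addr_def)

text \<open>Constants that serve as addresses, kept apart from constants that serve as numbers.\<close>

definition cell :: "nat \<Rightarrow> expr" where "cell n = Num (int n)"
definition rd :: "nat \<Rightarrow> expr" where "rd n = Mem (cell n)"
definition put :: "nat \<Rightarrow> expr \<Rightarrow> prog" where "put n e = Store (cell n) e"

lemma val_cell [simp]: "val (cell n) m = real n" by (simp add: cell_def)
lemma val_rd [simp]: "val (rd n) m = m n" by (simp add: rd_def)
lemma effect_put [simp]: "effect (put n e) m = m(n := val e m)" by (simp add: put_def)
lemma straight_put [simp]: "straight (put n e)" by (simp add: put_def)

primrec sum_expr :: "(nat \<Rightarrow> expr) \<Rightarrow> nat \<Rightarrow> expr" where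
  "sum_expr f 0 = Num 0"
| "sum_expr f (Suc n) = Add (sum_expr f n) (f (Suc n))"

lemma val_sum_expr [simp]: "val (sum_expr f n) m = (\<Sum>i=1..n. val (f i) m)"
  by (induction n) simp_all

lemma computable_linear:
  fixes p C :: "nat \<Rightarrow> real"
  shows "computable_fun k (map C [1..<Suc k] @ [M]) D (\<lambda>p. \<Sum>i=1..k. C i * p i)"
  unfolding computable_fun_def outputs_def
proof (intro exI ballI)
  fix p :: "nat \<Rightarrow> real"
  let ?e = "sum_expr (\<lambda>i. Mul (rd (k + i - 1)) (rd (i - 1))) k"
  let ?vs = "map p [1..<Suc k] @ map C [1..<Suc k] @ [M]"
  have "val ?e (fst (init ?vs)) = (\<Sum>i=1..k. C i * p i)"
    unfolding val_sum_expr by (intro sum.cong refl) (auto simp: init_def nth_append less_diff_conv2)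
  then show "exec (\<lambda>i j. False) (put 0 ?e) (init ?vs) (effect (put 0 ?e) (fst (init ?vs)), \<lambda>_. 0)
     \<and> effect (put 0 ?e) (fst (init ?vs)) 0 = (\<Sum>i=1..k. C i * p i)"
    using exec_straight[of "put 0 ?e" "\<lambda>i j. False" "fst (init ?vs)" "\<lambda>_. 0"] by (simp add: init_def)
qed

section \<open>The stages of the walk\<close>

text \<open>In stage \<open>j\<close> the walk goes up at rate 1 and down at rate \<open>down j * s\<close>, where \<open>s = r / M\<close> lies in \<open>[0, 1]\<close>.  Its
  drift is thus at least \<open>1 / 2 ^ (j + 1)\<close> for all admissible coins.\<close>

definition down :: "nat \<Rightarrow> real" where
  "down j = 1 - 1 / 2 ^ (j + 1)"

text \<open>The ceiling of stage \<open>j\<close>, which is also the level in which stage \<open>j + 1\<close> starts.\<close>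

definition top_level :: "nat \<Rightarrow> nat" where
  "top_level j = 2 ^ (j + 3)"

text \<open>From level \<open>i\<close> of stage \<open>j\<close> the output is 1 with probability \<open>gain j * (down j * s) ^ i\<close>; in particular
  \<open>gain j\<close> is the probability of acceptance in level 0.  From the second stage on it is normalised such that the
  coefficient \<open>gain j * down j ^ i\<close> is \<open>1 / 10\<close> in the starting level of the stage: a value that can be
  computed without taking powers.\<close>

fun gain :: "nat \<Rightarrow> real" where
  "gain 0 = 1"
| "gain (Suc j) = (1 / 10) / down (Suc j) ^ 2 ^ (j + 3)"

text \<open>The coefficient of \<open>s ^ top_level j\<close> in the success probability at the ceiling, divided by the coefficient
  \<open>1 / 10\<close> at the start of the next stage.\<close>

definition survive :: "nat \<Rightarrow> real" where
  "survive j = 10 * (gain j * down j ^ top_level j)"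

lemma top_level_Suc: "top_level (Suc j) = 2 * top_level j"
  by (simp add: top_level_def power_add)

lemma top_level_ge: "8 \<le> top_level j"
  by (simp add: top_level_def power_add)

lemma down_0: "down 0 = 1 / 2" by (simp add: down_def)

lemma down_Suc: "down (Suc j) = (1 + down j) / 2"
  by (simp add: down_def field_simps)

lemma down_bounds: "1 / 2 \<le> down j" "0 < down j" "down j < 1"
proof -
  have "(2::real) * 1 \<le> 2 * 2 ^ j" by (intro mult_left_mono) simp_all
  then show "1 / 2 \<le> down j" by (simp add: down_def field_simps)
  then show "0 < down j" by linarith
  show "down j < 1" by (simp add: down_def)
qed

text \<open>These powers increase with \<open>j\<close>, since \<open>(1 - x / 2)^2 \<ge> 1 - x\<close>, and the first of them is \<open>(3 / 4) ^ 8 > 1 / 10\<close>.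
  It is the reason for the constant \<open>1 / 10\<close>, which makes \<open>gain j\<close> a probability.\<close>

lemma down_power_ge: "1 / 10 \<le> down (Suc j) ^ 2 ^ (j + 3)"
proof (induction j)
  case 0
  show ?case by (simp add: down_def power_divide)
next
  case (Suc j)
  have "down (Suc j) \<le> down (Suc (Suc j)) ^ 2"
    unfolding down_Suc[of "Suc j"] using zero_le_power2[of "1 - down (Suc j)"]
    by (simp add: power2_eq_square field_simps)
  then have "down (Suc j) ^ 2 ^ (j + 3) \<le> (down (Suc (Suc j)) ^ 2) ^ 2 ^ (j + 3)"
    using down_bounds(2) by (intro power_mono) (auto intro: less_imp_le)
  also have "\<dots> = down (Suc (Suc j)) ^ 2 ^ (Suc j + 3)"
    by (simp add: power_mult[symmetric] power_add mult.assoc)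
  finally show ?case using Suc by linarith
qed

text \<open>With \<open>n = 2 ^ (j + 2)\<close> this is \<open>(1 - 1 / n) ^ (2 * n) \<le> exp (- 2) \<le> 1 / 7\<close>, where \<open>exp 2\<close> is bounded from below
  through the quadratic Taylor polynomial at \<open>1 / 4\<close>.\<close>

lemma down_power_le: "down (Suc j) ^ 2 ^ (j + 3) \<le> 1 / 7"
proof -
  have "(7::real) \<le> (1 + (1/4) + (1/4)\<^sup>2 / 2) ^ 8" by (simp add: power2_eq_square power_divide)
  also have "\<dots> \<le> exp (1/4) ^ 8"
    by (intro power_mono exp_lower_Taylor_quadratic) auto
  also have "\<dots> = exp 2" by (simp add: exp_of_nat_mult[symmetric])
  finally have e: "7 \<le> exp (2::real)" .
  have "down (Suc j) \<le> exp (- (1 / 2 ^ (j + 2)))"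
    using exp_ge_add_one_self[of "- (1 / 2 ^ (j + 2)) :: real"] by (simp add: down_def)
  then have "down (Suc j) ^ 2 ^ (j + 3) \<le> exp (- (1 / 2 ^ (j + 2))) ^ 2 ^ (j + 3)"
    using down_bounds(2)[of "Suc j"] by (intro power_mono) auto
  also have "\<dots> = exp (- 2)"
    by (simp add: exp_of_nat_mult[symmetric] power_add)
  also have "\<dots> \<le> 1 / 7" using e by (simp add: exp_minus field_simps)
  finally show ?thesis .
qed

lemma gain_bounds: "0 < gain j" "gain j \<le> 1"
proof -
  show "0 < gain j" using down_bounds(2) by (cases j) auto
  show "gain j \<le> 1"
  proof (cases j)
    case (Suc i)
    then show ?thesis using down_power_ge[of i] down_bounds(2)[of "Suc i"] by (simp add: field_simps)
  qed simp
qed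

lemma survive_0: "survive 0 = 10 / 256"
  by (simp add: survive_def top_level_def down_0 power_divide)

lemma survive_Suc: "survive (Suc j) = down (Suc j) ^ 2 ^ (j + 3)"
proof -
  have "down (Suc j) ^ top_level (Suc j) = down (Suc j) ^ 2 ^ (j + 3) * down (Suc j) ^ 2 ^ (j + 3)"
    unfolding top_level_Suc mult_2 power_add by (simp add: top_level_def power_add)
  then show ?thesis using down_bounds(2)[of "Suc j"] by (simp add: survive_def)
qed

lemma survive_bounds: "0 \<le> survive j" "survive j \<le> 1" "0 < j \<Longrightarrow> survive j \<le> 1 / 7"
proof -
  show "0 \<le> survive j" using gain_bounds(1)[of j] down_bounds(2)[of j] by (simp add: survive_def)
  show "survive j \<le> 1"
  proof (cases j)
    case (Suc i)
    then show ?thesis using down_power_le[of i] by (simp add: survive_Suc)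
  qed (simp add: survive_0)
  show "0 < j \<Longrightarrow> survive j \<le> 1 / 7"
    by (cases j) (use down_power_le in \<open>auto simp: survive_Suc\<close>)
qed

section \<open>The protocol for small means\<close>

text \<open>The states belong to level \<open>i\<close> of stage \<open>j\<close>, where level 0 of stage 0 stands for the first race, before the walk
  has started.  A race is settled coin by coin: in \<open>Scan l i j\<close> the coins before \<open>l\<close> have been passed over,
  in \<open>Coin l i j\<close> coin \<open>l\<close> is to be flipped, and \<open>Event b i j\<close> ends the race, with heads if \<open>b\<close> and with the alarm
  otherwise.\<close>

datatype state = Scan nat nat nat | Coin nat nat nat | Event bool nat nat | Stop bool

locale small_mean =
  fixes k :: nat and C :: "nat \<Rightarrow> real" and M :: real
  assumes k: "1 \<le> k" and C: "\<And>i. i \<in> {1..k} \<Longrightarrow> 0 < C i" and M: "0 < M" "M < 1/2"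
begin

text \<open>The factor \<open>a\<close> by which the rates \<open>C n\<close> are multiplied in the race.\<close>

definition scale :: "nat \<Rightarrow> nat \<Rightarrow> real" where
  "scale i j = (if i = 0 then 1 / (1 - 2 * M) else down j / M)"

text \<open>The total rate of the alarm and of the coins from \<open>l\<close> on.\<close>

definition weight :: "nat \<Rightarrow> nat \<Rightarrow> nat \<Rightarrow> real" where
  "weight l i j = 1 + scale i j * (\<Sum>n=l..k. C n)"

text \<open>After tails the race starts anew.  Heads in level 1 lead to level 0, where the walk ends and is accepted with
  probability \<open>gain j\<close>.  Branching with probability 1 or 0 is used for moves that are not random.\<close>

primrec act :: "state \<Rightarrow> state action" where
  "act (Scan l i j) = Branch (scale i j * C l / weight l i j) (Coin l i j)
     (if l < k then Scan (Suc l) i j else Event False i j)"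
| "act (Coin l i j) = Toss l (Event True i j) (Scan 1 i j)"
| "act (Event b i j) =
    (if b then
       if i = 0 then Branch (2 * M) (Scan 1 1 0) (Stop True)
       else if i = 1 then Branch (gain j) (Stop True) (Stop False)
       else Branch 1 (Scan 1 (i - 1) j) (Stop False)
     else
       if i = 0 then Branch 0 (Stop False) (Stop False)
       else if Suc i < top_level j then Branch 1 (Scan 1 (Suc i) j) (Stop False)
       else Branch (survive j) (Scan 1 (Suc i) (Suc j)) (Stop False))"
| "act (Stop b) = Halt b"

definition valid :: "nat \<Rightarrow> nat \<Rightarrow> bool" where
  "valid i j \<longleftrightarrow> i = 0 \<and> j = 0 \<or> 0 < i \<and> i < top_level j"

definition states :: "state set" where
  "states = {s. case s of Scan l i j \<Rightarrow> l \<in> {1..k} \<and> valid i j | Coin l i j \<Rightarrow> l \<in> {1..k} \<and> valid i j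
     | Event b i j \<Rightarrow> valid i j | Stop b \<Rightarrow> True}"

lemma valid_init: "valid (Suc 0) 0"
  by (simp add: valid_def top_level_def)

lemma valid_down: "valid i j \<Longrightarrow> 1 < i \<Longrightarrow> valid (i - Suc 0) j"
  by (auto simp: valid_def)

lemma valid_up: "0 < i \<Longrightarrow> Suc i < top_level j \<Longrightarrow> valid (Suc i) j"
  by (simp add: valid_def)

lemma valid_stage: "valid i j \<Longrightarrow> 0 < i \<Longrightarrow> valid (Suc i) (Suc j)"
  using top_level_ge[of j] by (auto simp: valid_def top_level_Suc)

lemma states_simps [simp]:
  "Scan l i j \<in> states \<longleftrightarrow> l \<in> {1..k} \<and> valid i j"
  "Coin l i j \<in> states \<longleftrightarrow> l \<in> {1..k} \<and> valid i j"
  "Event b i j \<in> states \<longleftrightarrow> valid i j"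
  "Stop b \<in> states"
  by (simp_all add: states_def)

lemma scale_pos: "0 < scale i j"
  using M down_bounds(2)[of j] by (simp add: scale_def)

lemma weight_pos: "1 \<le> l \<Longrightarrow> 1 \<le> weight l i j"
proof -
  assume "1 \<le> l"
  then have "0 \<le> (\<Sum>n=l..k. C n)" using C by (intro sum_nonneg less_imp_le) auto
  then show ?thesis using scale_pos[of i j] by (simp add: weight_def)
qed

lemma weight_step:
  assumes "l \<in> {1..k}"
  shows "weight l i j = scale i j * C l + weight (Suc l) i j"
  using assms by (simp add: weight_def sum.atLeast_Suc_atMost algebra_simps)

lemma legal_act: "legal k act states"
  unfolding legal_def
proof
  fix s assume s: "s \<in> states"
  show "case act s of Halt b \<Rightarrow> True
    | Branch q s1 s2 \<Rightarrow> q \<in> {0..1} \<and> s1 \<in> states \<and> s2 \<in> states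
    | Toss i s1 s2 \<Rightarrow> i \<in> {1..k} \<and> s1 \<in> states \<and> s2 \<in> states"
  proof (cases s)
    case (Scan l i j)
    then have l: "l \<in> {1..k}" using s by simp
    have "0 \<le> scale i j * C l" using scale_pos[of i j] C[OF l] by simp
    moreover have "1 \<le> weight (Suc l) i j" by (rule weight_pos) simp
    ultimately have "scale i j * C l / weight l i j \<in> {0..1}"
      using weight_step[OF l, of i j] by (simp add: divide_simps)
    then show ?thesis using s Scan by auto
  next
    case (Event b i j)
    then have "valid i j" using s by simp
    from valid_init valid_down[OF this] valid_up[of i j] valid_stage[OF this]
    show ?thesis using M gain_bounds[of j] survive_bounds[of j] k by (auto simp: Event)
  qed (use s k in auto)
qed

end

section \<open>Extending values from race starts to all states\<close>

text \<open>Each toss costs \<open>f\<close>, and each action before halting costs \<open>e\<close>.\<close>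

definition price :: "real \<Rightarrow> real \<Rightarrow> 's action \<Rightarrow> real" where
  "price f e a = (case a of Halt b \<Rightarrow> 0 | Branch q s1 s2 \<Rightarrow> e | Toss i s1 s2 \<Rightarrow> f + e)"

locale small_mean_coins = small_mean +
  fixes p :: "nat \<Rightarrow> real" and r :: real
  assumes p: "\<And>i. i \<in> {1..k} \<Longrightarrow> p i \<in> {0..1}" and r: "r = (\<Sum>i=1..k. C i * p i)" "r \<le> M"
begin

text \<open>The rate of heads in the race.\<close>

definition rate :: "nat \<Rightarrow> nat \<Rightarrow> real" where
  "rate i j = scale i j * r"

definition Ctot :: real where "Ctot = (\<Sum>i=1..k. C i)"

lemma r_nonneg: "0 \<le> r"
  unfolding r using C p by (intro sum_nonneg mult_nonneg_nonneg) (auto intro: less_imp_le)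

lemma r_le_Ctot: "r \<le> Ctot"
  unfolding r Ctot_def using C p by (intro sum_mono mult_left_le) (auto intro: less_imp_le)

lemma Ctot_pos: "0 < Ctot"
  unfolding Ctot_def using C k by (intro sum_pos) auto

text \<open>The expected value after the event \<open>b\<close> of a race, if \<open>w\<close> gives the values at the starts of races and \<open>z\<close> the
  values of the outputs.\<close>

primrec after :: "(nat \<Rightarrow> nat \<Rightarrow> real) \<Rightarrow> (bool \<Rightarrow> real) \<Rightarrow> bool \<Rightarrow> nat \<Rightarrow> nat \<Rightarrow> real" where
  "after w z True = (\<lambda>i j. if i = 0 then 2 * M * w 1 0 + (1 - 2 * M) * z True
     else if i = 1 then gain j * z True + (1 - gain j) * z False else w (i - 1) j)"
| "after w z False = (\<lambda>i j. if i = 0 then z False else if Suc i < top_level j then w (Suc i) j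
     else survive j * w (Suc i) (Suc j) + (1 - survive j) * z False)"

context
  fixes f e :: real and w :: "nat \<Rightarrow> nat \<Rightarrow> real" and z :: "bool \<Rightarrow> real"
begin

definition coin_value :: "nat \<Rightarrow> nat \<Rightarrow> nat \<Rightarrow> real" where
  "coin_value l i j = f + e + (p l * (e + after w z True i j) + (1 - p l) * w i j)"

text \<open>The values for the states inside a race that are forced by the values \<open>w\<close> and \<open>z\<close> and the prices.
  In a scan the events are averaged with their rates, and the price of scanning is replaced by its
  upper bound \<open>e\<close> per remaining coin.\<close>

primrec extend :: "state \<Rightarrow> real" where
  "extend (Stop b) = z b"
| "extend (Event b i j) = e + after w z b i j"
| "extend (Coin l i j) = coin_value l i j"
| "extend (Scan l i j) = e * (real (Suc k) - real l)
     + (e + after w z False i j + scale i j * (\<Sum>n=l..k. C n * coin_value n i j)) / weight l i j"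

end

text \<open>If coin \<open>l\<close> is not selected, the race continues among the later coins and the alarm with their rates unchanged.\<close>

lemma extend_Scan_step:
  fixes f e :: real and w :: "nat \<Rightarrow> nat \<Rightarrow> real" and z :: "bool \<Rightarrow> real" and l i j :: nat
  assumes l: "l \<in> {1..k}" and e: "0 \<le> e"
  defines "q \<equiv> scale i j * C l / weight l i j"
  defines "F \<equiv> extend f e w z"
  shows "e + (q * F (Coin l i j) + (1 - q) * F (if l < k then Scan (Suc l) i j else Event False i j)) \<le> F (Scan l i j)"
proof -
  define W where "W = weight l i j"
  define W' where "W' = weight (Suc l) i j"
  define X where "X = e + after w z False i j"
  define Y where "Y = scale i j * (\<Sum>n=Suc l..k. C n * coin_value f e w z n i j)"
  define x where "x = scale i j * C l"
  have W': "1 \<le> W'" unfolding W'_def by (rule weight_pos) simp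
  have x: "0 < x" using scale_pos C[OF l] by (simp add: x_def)
  have W: "W = x + W'" unfolding W_def W'_def x_def by (rule weight_step[OF l])
  have q: "q = x / W" by (simp add: q_def W_def x_def)
  have q': "1 - q = W' / W" unfolding q using W x W' by (simp add: field_simps)
  have nxt: "F (if l < k then Scan (Suc l) i j else Event False i j) = e * (real k - real l) + (X + Y) / W'"
    using l by (auto simp: F_def X_def Y_def W'_def weight_def)
  have cur: "F (Scan l i j) = e * (real (Suc k) - real l) + (X + (x * coin_value f e w z l i j + Y)) / W"
    using l by (simp add: F_def X_def Y_def W_def x_def sum.atLeast_Suc_atMost algebra_simps)
  have "(1 - q) * (e * (real k - real l)) \<le> 1 * (e * (real k - real l))"
    unfolding q' using W x W' e l by (intro mult_right_mono mult_nonneg_nonneg) auto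
  moreover have "q * coin_value f e w z l i j + (1 - q) * ((X + Y) / W') = (X + (x * coin_value f e w z l i j + Y)) / W"
  proof -
    have "(1 - q) * ((X + Y) / W') = (X + Y) / W" unfolding q' using W' by simp
    then show ?thesis by (simp only:) (simp add: q add_divide_distrib)
  qed
  ultimately show ?thesis unfolding nxt cur by (simp add: F_def algebra_simps)
qed

text \<open>Tails lead back to \<open>w i j\<close> itself.  Moving this contribution to the other side leaves \<open>1 + rate i j\<close> of the total
  rate \<open>1 + scale i j * Ctot\<close> and gives the assumption \<open>race\<close>.\<close>

lemma extend_Scan_le:
  assumes e: "0 \<le> e" and ij: "valid i j"
    and race: "f * (scale i j * Ctot) + e * (real k * (1 + scale i j * Ctot) + 1 + 2 * (scale i j * Ctot))
       + after w z False i j + rate i j * after w z True i j \<le> (1 + rate i j) * w i j"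
  shows "extend f e w z (Scan 1 i j) \<le> w i j"
proof -
  define a where "a = scale i j"
  define T where "T = after w z True i j"
  define E where "E = after w z False i j"
  have a: "0 < a" using scale_pos by (simp add: a_def)
  have W: "weight 1 i j = 1 + a * Ctot" by (simp add: weight_def a_def Ctot_def)
  have Wpos: "1 \<le> weight 1 i j" by (rule weight_pos) simp
  have "(\<Sum>n=1..k. C n * coin_value f e w z n i j) = (\<Sum>n=1..k. (f + e + w i j) * C n + (e + T - w i j) * (C n * p n))"
    by (intro sum.cong refl) (simp add: coin_value_def T_def algebra_simps)
  also have "\<dots> = (f + e + w i j) * Ctot + (e + T - w i j) * r"
    by (simp add: sum.distrib sum_distrib_left Ctot_def r)
  finally have sum: "(\<Sum>n=1..k. C n * coin_value f e w z n i j) = (f + e + w i j) * Ctot + (e + T - w i j) * r" .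
  have "extend f e w z (Scan 1 i j) = e * real k + (e + E + a * ((f + e + w i j) * Ctot + (e + T - w i j) * r)) / (1 + a * Ctot)"
    by (simp add: sum[simplified] W[simplified] a_def[symmetric] E_def)
  moreover have "e * (a * r) \<le> e * (a * Ctot)"
    using e a r_le_Ctot by (intro mult_left_mono) auto
  then have "e * real k * (1 + a * Ctot) + (e + E + a * ((f + e + w i j) * Ctot + (e + T - w i j) * r)) \<le> w i j * (1 + a * Ctot)"
    using race unfolding rate_def a_def[symmetric] T_def[symmetric] E_def[symmetric] by (simp add: algebra_simps)
  then have "e * real k + (e + E + a * ((f + e + w i j) * Ctot + (e + T - w i j) * r)) / (1 + a * Ctot) \<le> w i j"
    using Wpos W by (simp add: field_simps)
  ultimately show ?thesis by simp
qed

lemma after_nonneg: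
  assumes w: "\<And>i j. valid i j \<Longrightarrow> 0 \<le> w i j" and z: "\<And>b. 0 \<le> z b" and ij: "valid i j"
  shows "0 \<le> after w z b i j"
proof -
  show ?thesis
    using valid_init valid_down[OF ij] valid_up[of i j] valid_stage[OF ij] M gain_bounds[of j] survive_bounds[of j] w z
    by (cases b) auto
qed

lemma extend_nonneg:
  assumes w: "\<And>i j. valid i j \<Longrightarrow> 0 \<le> w i j" and z: "\<And>b. 0 \<le> z b" and fe: "0 \<le> f" "0 \<le> e"
    and s: "s \<in> states"
  shows "0 \<le> extend f e w z s"
proof -
  have cv: "0 \<le> coin_value f e w z l i j" if "l \<in> {1..k}" "valid i j" for l i j
    using after_nonneg[where w=w and z=z and b=True, OF w z that(2)] w[OF that(2)] p[OF that(1)] fe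
    unfolding coin_value_def by (intro add_nonneg_nonneg mult_nonneg_nonneg) auto
  show ?thesis
  proof (cases s)
    case (Scan l i j)
    then have l: "l \<in> {1..k}" and ij: "valid i j" using s by auto
    have "0 \<le> (\<Sum>n=l..k. C n * coin_value f e w z n i j)"
      using l C ij by (intro sum_nonneg mult_nonneg_nonneg cv) (auto intro: less_imp_le)
    moreover have "0 < scale i j" "1 \<le> weight l i j" using scale_pos weight_pos l by auto
    ultimately show ?thesis using after_nonneg[where w=w and z=z and b=False, OF w z ij] fe l Scan
      by (auto intro!: add_nonneg_nonneg divide_nonneg_nonneg)
  next
    case (Event b i j)
    then show ?thesis using s after_nonneg[where w=w and z=z, OF w z] fe by simp
  qed (use s cv z in auto)
qed

text \<open>This reduces supersolutions on all states to one inequality for each level.\<close>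

lemma extend_supersolution:
  assumes w: "\<And>i j. valid i j \<Longrightarrow> 0 \<le> w i j" and z: "\<And>b. 0 \<le> z b" and fe: "0 \<le> f" "0 \<le> e"
    and race: "\<And>i j. valid i j \<Longrightarrow> f * (scale i j * Ctot) + e * (real k * (1 + scale i j * Ctot) + 1 + 2 * (scale i j * Ctot))
       + after w z False i j + rate i j * after w z True i j \<le> (1 + rate i j) * w i j"
    and s: "s \<in> states"
  shows "ennreal (price f e (act s)) + average p act (\<lambda>s. ennreal (extend f e w z s)) s \<le> ennreal (extend f e w z s)"
proof -
  define F where "F = extend f e w z"
  have F0: "s \<in> states \<Longrightarrow> 0 \<le> F s" for s unfolding F_def by (rule extend_nonneg[OF w z fe])
  have F_Stop: "F (Stop b) = z b" for b by (simp add: F_def)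
  have le: "F (Scan (Suc 0) i j) \<le> w i j" if "valid i j" for i j
    using extend_Scan_le[OF fe(2) that race[OF that]] by (simp add: F_def)
  \<comment> \<open>On nonnegative values the condition can be checked in the reals.\<close>
  have real: "ennreal e' + (ennreal q * ennreal (F s1) + ennreal (1 - q) * ennreal (F s2)) \<le> ennreal (F s)"
    if "e' + (q * F s1 + (1 - q) * F s2) \<le> F s" "0 \<le> q" "q \<le> 1" "0 \<le> e'" "s1 \<in> states" "s2 \<in> states" for e' q s1 s2 s
    using that F0 by (simp add: ennreal_mult[symmetric] ennreal_plus[symmetric] ennreal_leI del: ennreal_plus)
  have mono: "q * x + (1 - q) * y \<le> q * x' + (1 - q) * y'" if "0 \<le> q" "q \<le> 1" "x \<le> x'" "y \<le> y'" for q x y x' y' :: real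
    using that by (intro add_mono mult_left_mono) auto
  show ?thesis unfolding F_def[symmetric]
  proof (cases s)
    case (Stop b)
    then show "ennreal (price f e (act s)) + average p act (\<lambda>s. ennreal (F s)) s \<le> ennreal (F s)"
      by (simp add: price_def average_def)
  next
    case (Coin l i j)
    then have "act s = Toss l (Event True i j) (Scan 1 i j)" by simp
    note st = legal_Toss[OF legal_act s this]
    have "f + e + (p l * F (Event True i j) + (1 - p l) * F (Scan 1 i j)) \<le> F s"
      using mono[of "p l" "F (Event True i j)" "F (Event True i j)" "F (Scan 1 i j)" "w i j"] p[OF st(1)] le s Coin
      by (simp add: F_def coin_value_def)
    from real[OF this] p[OF st(1)] st(2,3) fe Coin
    show "ennreal (price f e (act s)) + average p act (\<lambda>s. ennreal (F s)) s \<le> ennreal (F s)"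
      by (simp add: price_def average_def)
  next
    case (Scan l i j)
    define q s2 where "q = scale i j * C l / weight l i j" and "s2 = (if l < k then Scan (Suc l) i j else Event False i j)"
    have a: "act s = Branch q (Coin l i j) s2" by (simp add: Scan q_def s2_def)
    note st = legal_Branch[OF legal_act s a]
    have "e + (q * F (Coin l i j) + (1 - q) * F s2) \<le> F s"
      using extend_Scan_step[of l e i j f w z] fe(2) s unfolding F_def q_def s2_def Scan by simp
    from real[OF this st(1,2) fe(2) st(3,4)]
    show "ennreal (price f e (act s)) + average p act (\<lambda>s. ennreal (F s)) s \<le> ennreal (F s)"
      by (simp only: price_def average_def a action.case)
  next
    case (Event b i j)
    then have ij: "valid i j" using s by simp
    have "\<exists>q s1 s2. act s = Branch q s1 s2" by (simp add: Event)
    then obtain q s1 s2 where a: "act s = Branch q s1 s2" by blast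
    note st = legal_Branch[OF legal_act s a]
    have "q * F s1 + (1 - q) * F s2 \<le> after w z b i j"
      using a st(1,2) valid_init valid_down[OF ij] valid_up[of i j] valid_stage[OF ij] le unfolding Event
      by (cases b) (auto split: if_splits simp: F_Stop intro!: mult_left_mono)
    then have "e + (q * F s1 + (1 - q) * F s2) \<le> F s" by (simp add: F_def Event)
    from real[OF this st(1,2) fe(2) st(3,4)]
    show "ennreal (price f e (act s)) + average p act (\<lambda>s. ennreal (F s)) s \<le> ennreal (F s)"
      by (simp only: price_def average_def a action.case)
  qed
qed

section \<open>Output probabilities\<close>

definition ratio :: real where "ratio = r / M"

lemma ratio_bounds: "0 \<le> ratio" "ratio \<le> 1"
  using r_nonneg r(2) M by (simp_all add: ratio_def)

lemma rate_0: "rate 0 j = r / (1 - 2 * M)"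
  by (simp add: rate_def scale_def)

lemma rate_walk: "0 < i \<Longrightarrow> rate i j = down j * ratio"
  by (simp add: rate_def scale_def ratio_def)

lemma rate_walk_bounds: "0 \<le> down j * ratio" "down j * ratio \<le> down j"
  using ratio_bounds down_bounds(2)[of j] by (simp_all add: mult_left_le)

text \<open>The probability of output 1 from the start of a race.\<close>

definition target :: "nat \<Rightarrow> nat \<Rightarrow> real" where
  "target i j = (if i = 0 then r else gain j * (down j * ratio) ^ i)"

lemma target_bounds: "0 \<le> target i j" "target i j \<le> 1"
proof -
  have y: "0 \<le> down j * ratio" "down j * ratio \<le> 1"
    using rate_walk_bounds[of j] down_bounds(3)[of j] by auto
  show "0 \<le> target i j" using y gain_bounds(1)[of j] r_nonneg by (simp add: target_def)
  have "gain j * (down j * ratio) ^ i \<le> 1"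
    using gain_bounds[of j] by (intro mult_le_one power_le_one[OF y] zero_le_power y(1)) auto
  then show "target i j \<le> 1" using r(2) M by (simp add: target_def)
qed

lemma after_target_True:
  assumes "0 < i"
  shows "after target of_bool True i j = gain j * (down j * ratio) ^ (i - 1)"
  using assms by (auto simp: target_def)

lemma after_target_False:
  assumes ij: "valid i j" and i: "0 < i"
  shows "after target of_bool False i j = gain j * (down j * ratio) ^ Suc i"
proof (cases "Suc i < top_level j")
  case True
  then show ?thesis using i by (simp add: target_def)
next
  case False
  then have top: "Suc i = top_level j" using ij i by (auto simp: valid_def)
  have "gain (Suc j) * down (Suc j) ^ top_level j = 1 / 10"
    using down_bounds(2)[of "Suc j"] by (simp add: top_level_def)
  then have eq: "survive j * (gain (Suc j) * (down (Suc j) * ratio) ^ top_level j) = gain j * (down j * ratio) ^ top_level j"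
    unfolding power_mult_distrib survive_def by (simp add: mult.assoc[symmetric])
  have "after target of_bool False i j = survive j * (gain (Suc j) * (down (Suc j) * ratio) ^ Suc i)"
    using False i by (simp add: target_def del: gain.simps power_Suc)
  then show ?thesis using eq top by (simp only:)
qed

text \<open>In a level of the walk this is \<open>y ^ (i + 1) + y * y ^ (i - 1) = (1 + y) * y ^ i\<close> with the rate \<open>y\<close> of heads; the
  probability \<open>survive j\<close> makes the ceiling no exception.  In the first race it says that output 1 has
  probability \<open>1 - 2 * M + r\<close> after heads.\<close>

lemma target_harmonic:
  assumes ij: "valid i j"
  shows "after target of_bool False i j + rate i j * after target of_bool True i j = (1 + rate i j) * target i j"
proof (cases "i = 0")
  case True
  then show ?thesis using M by (simp add: rate_0 target_def down_0 ratio_def field_simps)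
next
  case False
  then obtain n where "i = Suc n" by (cases i) auto
  then show ?thesis using ij
    by (simp only: after_target_True after_target_False rate_walk zero_less_Suc)
       (simp add: target_def algebra_simps)
qed

lemma after_complement: "after (\<lambda>i j. 1 - target i j) (\<lambda>b. 1 - of_bool b) b i j = 1 - after target of_bool b i j"
  by (cases b) (auto simp: algebra_simps)

text \<open>Since \<open>target\<close> satisfies the race condition with equality, its complement does so, too.\<close>

lemma target_supersolution:
  assumes s: "s \<in> states"
  defines "h \<equiv> \<lambda>b. if b then extend 0 0 target of_bool else extend 0 0 (\<lambda>i j. 1 - target i j) (\<lambda>b. 1 - of_bool b)"
  shows "average p act (\<lambda>s. ennreal (h b s)) s \<le> ennreal (h b s)"
proof (cases b)
  case True
  have "ennreal (price 0 0 (act s)) + average p act (\<lambda>s. ennreal (extend 0 0 target of_bool s)) s \<le> ennreal (extend 0 0 target of_bool s)"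
    using target_bounds target_harmonic s by (intro extend_supersolution) auto
  then show ?thesis using True by (simp add: h_def price_def split: action.splits)
next
  case False
  have "ennreal (price 0 0 (act s)) + average p act (\<lambda>s. ennreal (extend 0 0 (\<lambda>i j. 1 - target i j) (\<lambda>b. 1 - of_bool b) s)) s
      \<le> ennreal (extend 0 0 (\<lambda>i j. 1 - target i j) (\<lambda>b. 1 - of_bool b) s)"
  proof (intro extend_supersolution)
    fix i j assume "valid i j"
    from target_harmonic[OF this]
    show "0 * (scale i j * Ctot) + 0 * (real k * (1 + scale i j * Ctot) + 1 + 2 * (scale i j * Ctot)) +
        after (\<lambda>i j. 1 - target i j) (\<lambda>b. 1 - of_bool b) False i j +
        rate i j * after (\<lambda>i j. 1 - target i j) (\<lambda>b. 1 - of_bool b) True i j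
        \<le> (1 + rate i j) * (1 - target i j)"
      unfolding after_complement by (simp add: algebra_simps)
  qed (use target_bounds s in auto)
  then show ?thesis using False by (simp add: h_def price_def split: action.splits)
qed

lemma extend_target_start:
  "extend 0 0 target of_bool (Scan 1 0 0) \<le> r"
  "extend 0 0 (\<lambda>i j. 1 - target i j) (\<lambda>b. 1 - of_bool b) (Scan 1 0 0) \<le> 1 - r"
proof -
  have valid: "valid 0 0" by (simp add: valid_def)
  show "extend 0 0 target of_bool (Scan 1 0 0) \<le> r"
    using extend_Scan_le[of 0 0 0 0 target of_bool] target_harmonic[OF valid] valid by (simp add: target_def)
  have "0 * (scale 0 0 * Ctot) + 0 * (real k * (1 + scale 0 0 * Ctot) + 1 + 2 * (scale 0 0 * Ctot)) +
        after (\<lambda>i j. 1 - target i j) (\<lambda>b. 1 - of_bool b) False 0 0 +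
        rate 0 0 * after (\<lambda>i j. 1 - target i j) (\<lambda>b. 1 - of_bool b) True 0 0
        \<le> (1 + rate 0 0) * (1 - target 0 0)"
    unfolding after_complement using target_harmonic[OF valid] by (simp add: algebra_simps)
  from extend_Scan_le[OF order_refl valid this]
  show "extend 0 0 (\<lambda>i j. 1 - target i j) (\<lambda>b. 1 - of_bool b) (Scan 1 0 0) \<le> 1 - r"
    by (simp add: target_def)
qed

section \<open>Expected number of flips\<close>

text \<open>A bound for the expected price of a race, multiplied by the total rate of the events that end it: \<open>a * Ctot\<close>
  is the rate of tosses, and up to \<open>k\<close> scanning steps precede each toss and the alarm.\<close>

definition round_price :: "real \<Rightarrow> real \<Rightarrow> real \<Rightarrow> real" where
  "round_price f e a = f * (a * Ctot) + e * (real k * (1 + a * Ctot) + 1 + 2 * (a * Ctot))"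

lemma round_price_mono: "0 \<le> f \<Longrightarrow> 0 \<le> e \<Longrightarrow> a \<le> b \<Longrightarrow> round_price f e a \<le> round_price f e b"
  unfolding round_price_def using Ctot_pos
  by (intro add_mono mult_left_mono mult_right_mono) auto

lemma round_price_nonneg: "0 \<le> f \<Longrightarrow> 0 \<le> e \<Longrightarrow> 0 \<le> a \<Longrightarrow> 0 \<le> round_price f e a"
  unfolding round_price_def using Ctot_pos by (intro add_nonneg_nonneg mult_nonneg_nonneg) auto

text \<open>A bound for the expected remaining price in the stages \<open>j > 0\<close> if each race is priced by \<open>G\<close>.  It ignores that the walk may end
  in level 0: with drift at least \<open>1 / 2 ^ (j + 1)\<close> one level costs at most \<open>G * 2 ^ (j + 1)\<close>, hence
  the slope, and the constant \<open>80 / 3\<close> makes the value at the ceiling equal to \<open>1 / 7\<close> of the value at the start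
  of the next stage.\<close>

definition late_cost :: "real \<Rightarrow> nat \<Rightarrow> nat \<Rightarrow> real" where
  "late_cost G i j = G * (80 / 3 * 4 ^ j - 2 ^ (j + 1) * real i)"

text \<open>A bound for the expected remaining price in stage 0, if its races are priced by \<open>G\<close> and the later ones by \<open>H\<close>.  Here the
  possibility of ending in level 0 has to be used: with \<open>H = 2 * G\<close> a linear bound would give
  \<open>14 * G + 35 / 12 * H\<close> in level 1, which is more than \<open>15.2 * G\<close>.  The race equation is
  solved by combinations of \<open>1\<close>, \<open>y ^ i\<close> and \<open>i\<close>; the one used here vanishes in level 0 and is large enough in
  level 8 to pay \<open>35 / 12 * H\<close>, the price of the later stages times the probability \<open>10 / 256\<close> of survival.\<close>

definition first_cost :: "real \<Rightarrow> real \<Rightarrow> nat \<Rightarrow> real" where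
  "first_cost G H i = (let y = ratio / 2 in (9 * (G + 35 / 96 * H) * (1 - y ^ i) - G * real i) / (1 - y))"

lemma late_cost_nonneg:
  assumes "0 \<le> G" "i \<le> top_level j"
  shows "0 \<le> late_cost G i j"
proof -
  have "real i \<le> real (top_level j)" using assms(2) by simp
  then have "2 ^ (j + 1) * real i \<le> 2 ^ (j + 1) * 2 ^ (j + 3)"
    by (intro mult_left_mono) (simp_all add: top_level_def)
  also have "\<dots> = 16 * (2 ^ j * 2 ^ j)" by (simp add: power_add)
  also have "\<dots> = 16 * 4 ^ j" by (simp add: power_mult_distrib[symmetric])
  also have "\<dots> \<le> 80 / 3 * 4 ^ j" by simp
  finally show ?thesis using assms(1) unfolding late_cost_def by (intro mult_nonneg_nonneg) auto
qed

lemma late_cost_stage: "late_cost G (top_level j) (Suc j) = 7 * late_cost G (top_level j) j"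
proof -
  have "(2::real) ^ j * 2 ^ j = 4 ^ j" by (simp add: power_mult_distrib[symmetric])
  then show ?thesis by (simp add: late_cost_def top_level_def power_add algebra_simps)
qed

lemma late_cost_race:
  assumes G: "0 \<le> G" and y: "0 \<le> y" "y \<le> down j" and i: "0 < i"
  shows "G + late_cost G (Suc i) j + y * late_cost G (i - 1) j \<le> (1 + y) * late_cost G i j"
proof -
  have "1 \<le> 2 ^ (j + 1) * (1 - y)" using y(2) by (simp add: down_def field_simps)
  then have "G * 1 \<le> G * (2 ^ (j + 1) * (1 - y))" using G by (intro mult_left_mono)
  moreover have "(1 + y) * late_cost G i j - late_cost G (Suc i) j - y * late_cost G (i - 1) j = G * (2 ^ (j + 1) * (1 - y))"
    using i by (cases i) (auto simp: late_cost_def algebra_simps)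
  ultimately show ?thesis by linarith
qed

lemma first_cost_0: "first_cost G H 0 = 0"
  by (simp add: first_cost_def)

lemma half_ratio: "0 \<le> ratio / 2" "ratio / 2 \<le> 1 / 2"
  using ratio_bounds by simp_all

lemma first_cost_race:
  assumes i: "0 < i"
  shows "G + first_cost G H (Suc i) + ratio / 2 * first_cost G H (i - 1) = (1 + ratio / 2) * first_cost G H i"
proof -
  obtain n where n: "i = Suc n" using i by (cases i) auto
  define y where "y = ratio / 2"
  define A where "A = 9 * (G + 35 / 96 * H)"
  have y: "1 - y \<noteq> 0" using half_ratio by (simp add: y_def)
  have "G + (A * (1 - y ^ Suc i) - G * real (Suc i)) / (1 - y) + y * ((A * (1 - y ^ n) - G * real n) / (1 - y))
      = (1 + y) * ((A * (1 - y ^ i) - G * real i) / (1 - y))"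
    using y n by (simp add: divide_simps) (simp add: algebra_simps)
  then show ?thesis by (simp add: first_cost_def Let_def y_def A_def n)
qed

lemma first_cost_nonneg:
  assumes "0 \<le> G" "0 \<le> H" "i \<le> 8"
  shows "0 \<le> first_cost G H i"
proof (cases "i = 0")
  case False
  define y where "y = ratio / 2"
  have y: "0 \<le> y" "y \<le> 1 / 2" using half_ratio by (simp_all add: y_def)
  have "y ^ i \<le> (1 / 2) ^ i" using y by (intro power_mono)
  \<comment> \<open>A concave function of the level that is nonnegative at 0 and 8; the nine values are checked.\<close>
  moreover have "real i \<le> 9 * (1 - (1 / 2) ^ i)"
  proof -
    have "i \<in> {0, 1, 2, 3, 4, 5, 6, 7, 8}" using assms(3) by auto
    then show ?thesis by (auto simp: power_divide)
  qed
  moreover from calculation(1) have "9 * (1 - (1 / 2) ^ i) \<le> 9 * (1 - y ^ i)" by simp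
  ultimately have i: "real i \<le> 9 * (1 - y ^ i)" by (blast intro: order_trans)
  have "G * real i \<le> (G + 35 / 96 * H) * (9 * (1 - y ^ i))"
    using i assms by (intro mult_mono) auto
  then have "0 \<le> 9 * (G + 35 / 96 * H) * (1 - y ^ i) - G * real i"
    by (simp only: ac_simps)
  then have "0 \<le> (9 * (G + 35 / 96 * H) * (1 - y ^ i) - G * real i) / (1 - y)"
    using y by (intro divide_nonneg_nonneg) auto
  then show ?thesis by (simp add: first_cost_def Let_def y_def)
qed (simp add: first_cost_0)

lemma first_cost_stage:
  assumes "0 \<le> G" "0 \<le> H"
  shows "survive 0 * late_cost H 8 1 \<le> first_cost G H 8"
proof -
  define y where "y = ratio / 2"
  have y: "0 \<le> y" "y \<le> 1 / 2" using half_ratio by (simp_all add: y_def)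
  have "y ^ 8 \<le> (1 / 2) ^ 8" using y by (intro power_mono)
  then have "8 \<le> 9 * (1 - y ^ 8)" by (simp add: power_divide)
  then have "(G + 35 / 96 * H) * 8 \<le> (G + 35 / 96 * H) * (9 * (1 - y ^ 8))"
    using assms by (intro mult_left_mono) auto
  then have "35 / 12 * H \<le> 9 * (G + 35 / 96 * H) * (1 - y ^ 8) - G * 8" (is "_ \<le> ?N")
    by (simp only: ring_distribs)
  moreover from this have "?N * (1 - y) \<le> ?N * 1"
    using y assms by (intro mult_left_mono) auto
  then have "?N \<le> ?N / (1 - y)" using y by (simp add: field_simps)
  ultimately have "35 / 12 * H \<le> ?N / (1 - y)" by (rule order_trans)
  moreover have "survive 0 * late_cost H 8 1 = 35 / 12 * H"
    by (simp add: survive_0 late_cost_def)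
  moreover have "first_cost G H 8 = ?N / (1 - y)"
    by (simp add: first_cost_def Let_def y_def)
  ultimately show ?thesis by (simp only:)
qed

text \<open>For the first race this is the solution of its race equation.\<close>

definition cost :: "real \<Rightarrow> real \<Rightarrow> nat \<Rightarrow> nat \<Rightarrow> real" where
  "cost f e i j = (let G = round_price f e (1 / 2 / M); H = round_price f e (1 / M) in
     if i = 0 then (round_price f e (1 / (1 - 2 * M)) + rate 0 0 * (2 * M * first_cost G H 1)) / (1 + rate 0 0)
     else if j = 0 then first_cost G H i else late_cost H i j)"

lemma cost_nonneg:
  assumes fe: "0 \<le> f" "0 \<le> e" and ij: "valid i j"
  shows "0 \<le> cost f e i j"
proof -
  have G: "0 \<le> round_price f e (1 / 2 / M)" "0 \<le> round_price f e (1 / M)" "0 \<le> round_price f e (1 / (1 - 2 * M))"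
    using M by (auto intro!: round_price_nonneg fe)
  have "0 \<le> rate 0 0" using r_nonneg M by (simp add: rate_0)
  then show ?thesis
    using G ij M first_cost_nonneg[OF G(1,2), of 1] first_cost_nonneg[OF G(1,2), of i] late_cost_nonneg[OF G(2), of i j]
    by (auto simp: cost_def Let_def valid_def top_level_def intro!: divide_nonneg_nonneg add_nonneg_nonneg mult_nonneg_nonneg)
qed

lemma cost_race:
  assumes fe: "0 \<le> f" "0 \<le> e" and ij: "valid i j"
  shows "f * (scale i j * Ctot) + e * (real k * (1 + scale i j * Ctot) + 1 + 2 * (scale i j * Ctot))
       + after (cost f e) (\<lambda>_. 0) False i j + rate i j * after (cost f e) (\<lambda>_. 0) True i j \<le> (1 + rate i j) * cost f e i j"
proof -
  define G where "G = round_price f e (1 / 2 / M)"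
  define H where "H = round_price f e (1 / M)"
  have G0: "0 \<le> G" and H0: "0 \<le> H" using M by (auto simp: G_def H_def intro!: round_price_nonneg fe)
  have cost: "cost f e i 0 = first_cost G H i" "cost f e i (Suc j) = late_cost H i (Suc j)" if "0 < i" for i j
    using that by (simp_all add: cost_def G_def H_def)
  have "round_price f e (scale i j) + after (cost f e) (\<lambda>_. 0) False i j + rate i j * after (cost f e) (\<lambda>_. 0) True i j
      \<le> (1 + rate i j) * cost f e i j"
  proof (cases "i = 0")
    case True
    have "0 \<le> rate 0 0" using r_nonneg M by (simp add: rate_0)
    then show ?thesis using True ij
      by (simp add: valid_def cost_def scale_def G_def H_def Let_def)
  next
    case False
    then have i: "0 < i" "i < top_level j" using ij by (auto simp: valid_def)
    note rate = rate_walk[OF i(1)]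
    show ?thesis
    proof (cases j)
      case 0
      have heads: "after (cost f e) (\<lambda>_. 0) True i 0 = first_cost G H (i - 1)"
        using i by (auto simp: cost first_cost_0)
      \<comment> \<open>At the ceiling, level 8, the walk survives with probability 10 / 256.\<close>
      have up: "after (cost f e) (\<lambda>_. 0) False i 0 \<le> first_cost G H (Suc i)"
      proof (cases "Suc i < 8")
        case True
        then show ?thesis using i by (simp add: cost top_level_def)
      next
        case False
        then have "i = 7" using i 0 by (simp add: top_level_def)
        then show ?thesis using first_cost_stage[OF G0 H0] cost(2)[of 8 0] by (simp add: top_level_def)
      qed
      have price: "round_price f e (scale i 0) = G" using i by (simp add: scale_def G_def down_0)
      have rate0: "rate i 0 = ratio / 2" using i by (simp add: rate_walk down_0)
      show ?thesis
        using first_cost_race[OF i(1), of G H] up unfolding 0 heads price rate0 cost(1)[OF i(1)] by linarith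
    next
      case (Suc n)
      have y: "0 \<le> rate i j" "rate i j \<le> down j" using rate_walk_bounds[of j] rate by auto
      have "after (cost f e) (\<lambda>_. 0) True i j \<le> late_cost H (i - 1) j"
        using i Suc late_cost_nonneg[OF H0, of 0 j] by (auto simp: cost)
      then have "rate i j * after (cost f e) (\<lambda>_. 0) True i j \<le> rate i j * late_cost H (i - 1) j"
        using y by (intro mult_left_mono)
      moreover have "after (cost f e) (\<lambda>_. 0) False i j \<le> late_cost H (Suc i) j"
      proof (cases "Suc i < top_level j")
        case True
        then show ?thesis using i Suc by (simp add: cost)
      next
        case False
        then have top: "Suc i = top_level j" using i by simp
        have "survive j * (7 * late_cost H (top_level j) j) \<le> 1 / 7 * (7 * late_cost H (top_level j) j)"
          using survive_bounds(3)[of j] Suc late_cost_nonneg[OF H0, of "top_level j" j] by (intro mult_right_mono) auto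
        then show ?thesis using False i unfolding top by (simp add: cost late_cost_stage top)
      qed
      moreover have "round_price f e (scale i j) \<le> H"
        unfolding H_def using i M down_bounds(3)[of j] by (intro round_price_mono fe) (simp add: scale_def divide_right_mono)
      moreover have "H + late_cost H (Suc i) j + rate i j * late_cost H (i - 1) j \<le> (1 + rate i j) * late_cost H i j"
        by (rule late_cost_race[OF H0 y i(1)])
      ultimately show ?thesis using Suc i by (simp add: cost)
    qed
  qed
  then show ?thesis by (simp add: round_price_def)
qed

lemma cost_supersolution:
  assumes "0 \<le> f" "0 \<le> e" "s \<in> states"
  shows "ennreal (price f e (act s)) + average p act (\<lambda>s. ennreal (extend f e (cost f e) (\<lambda>_. 0) s)) s
    \<le> ennreal (extend f e (cost f e) (\<lambda>_. 0) s)"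
  using assms by (intro extend_supersolution cost_nonneg cost_race) auto

text \<open>The coin of bias \<open>s / 2\<close> costs at most \<open>first_cost G (2 * G) 1 \<le> (8 + 9 * 35 / 48) * G < 15.2 * G\<close> flips with
  \<open>G = Ctot / (2 * M)\<close>.  The flips of the first race fit into the first term of the bound because of
  \<open>(1 - 2 * M) * (1 + r) \<le> 1 - 2 * M + r\<close>.\<close>

lemma flip_cost_start:
  "extend 1 0 (cost 1 0) (\<lambda>_. 0) (Scan 1 0 0)
     \<le> Ctot / ((1 - 2 * M) * (1 + r)) + r * (Ctot * (15.2 / (1 - 2 * M + r)))"
proof -
  have valid: "valid 0 0" by (simp add: valid_def)
  define G where "G = Ctot / (2 * M)"
  have rp: "round_price 1 0 a = a * Ctot" for a by (simp add: round_price_def)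
  have G: "round_price 1 0 (1 / 2 / M) = G" "round_price 1 0 (1 / M) = 2 * G"
    by (simp_all add: rp G_def)
  have G0: "0 \<le> G" using Ctot_pos M by (simp add: G_def)
  have y: "0 \<le> ratio / 2" "ratio / 2 \<le> 1 / 2" by (rule half_ratio)+
  have alg: "(A * (1 - y ^ 1) - G * 1) / (1 - y) = A - G / (1 - y)" if "y \<le> 1 / 2" for A y :: real
    using that by (simp add: diff_divide_distrib)
  have "G \<le> G / (1 - ratio / 2)"
    using y G0 mult_left_mono[of "1 - ratio / 2" 1 G] by (simp add: pos_le_divide_eq)
  then have fc: "first_cost G (2 * G) 1 \<le> 15.2 * G"
    unfolding first_cost_def Let_def of_nat_1 alg[OF y(2)] using G0 by simp
  define d where "d = 1 - 2 * M"
  have d: "0 < d" using M by (simp add: d_def)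
  have "extend 1 0 (cost 1 0) (\<lambda>_. 0) (Scan 1 0 0) \<le> cost 1 0 0 0"
    by (rule extend_Scan_le[OF order_refl valid cost_race[OF _ _ valid]]) simp_all
  also have "\<dots> = (Ctot / d + r / d * (2 * M * first_cost G (2 * G) 1)) / (1 + r / d)"
    by (simp only: cost_def G Let_def if_True) (simp add: rp rate_0 d_def)
  also have "\<dots> = Ctot / (d + r) + r * (2 * M * first_cost G (2 * G) 1) / (d + r)"
    using d r_nonneg by (simp add: divide_simps)
  also have "\<dots> \<le> Ctot / (d * (1 + r)) + r * (2 * M * (15.2 * G)) / (d + r)"
  proof (intro add_mono divide_right_mono mult_left_mono fc divide_left_mono)
    have "0 \<le> M * r" using M r_nonneg by simp
    then show "d * (1 + r) \<le> d + r" by (simp add: d_def algebra_simps)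
  qed (use d r_nonneg M Ctot_pos in auto)
  also have "2 * M * (15.2 * G) = 15.2 * Ctot" using M by (simp add: G_def)
  finally show ?thesis unfolding d_def by (simp add: ac_simps)
qed

end

section \<open>A program for the protocol\<close>

context small_mean
begin

text \<open>The inputs occupy the cells 0 (the uniform number), 1 to \<open>k\<close> (the numbers \<open>C i\<close>) and \<open>k + 1\<close> (the number \<open>M\<close>).
  The mode is 0, 1, 2, 3 in the states \<open>Scan\<close>, \<open>Coin\<close>, \<open>Event\<close>, \<open>Stop\<close>.\<close>

abbreviation "mode_cell \<equiv> k + 2"
abbreviation "coin_cell \<equiv> k + 3"
abbreviation "rest_cell \<equiv> k + 4"
abbreviation "level_cell \<equiv> k + 5"
abbreviation "coeff_cell \<equiv> k + 6"
abbreviation "limit_cell \<equiv> k + 7"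
abbreviation "factor_cell \<equiv> k + 8"
abbreviation "scaling_cell \<equiv> k + 9"
abbreviation "flag_cell \<equiv> k + 10"
abbreviation "prob_cell \<equiv> k + 11"
abbreviation "result_cell \<equiv> k + 12"

definition draw :: prog where
  "draw = Cond (Less (rd 0) (rd prob_cell))
     (Seq (put 0 (Div (rd 0) (rd prob_cell))) (put result_cell (Num 1)))
     (Seq (put 0 (Div (Sub (rd 0) (rd prob_cell)) (Sub (Num 1) (rd prob_cell)))) (put result_cell (Num 0)))"

definition restart :: prog where
  "restart = Seq (put coin_cell (Num 1)) (Seq (put rest_cell (Add (Num 1) (Mul (rd scaling_cell) (sum_expr rd k)))) (put mode_cell (Num 0)))"

definition stop :: "int \<Rightarrow> prog" where
  "stop v = Seq (put 0 (Num v)) (put mode_cell (Num 3))"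

definition if_drawn :: "prog \<Rightarrow> prog \<Rightarrow> prog" where
  "if_drawn c d = Seq draw (Cond (Less (Num 0) (rd result_cell)) c d)"

definition scan_prog :: prog where
  "scan_prog = Seq (put prob_cell (Div (Mul (rd scaling_cell) (Mem (rd coin_cell))) (rd rest_cell)))
     (if_drawn (put mode_cell (Num 1))
       (Cond (Less (rd coin_cell) (cell k))
         (Seq (put rest_cell (Sub (rd rest_cell) (Mul (rd scaling_cell) (Mem (rd coin_cell))))) (put coin_cell (Add (rd coin_cell) (Num 1))))
         (Seq (put flag_cell (Num 0)) (put mode_cell (Num 2)))))"

definition coin_prog :: prog where
  "coin_prog = Seq (Flip (cell flag_cell) (rd coin_cell))
     (Cond (Less (Num 0) (rd flag_cell)) (put mode_cell (Num 2)) restart)"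

definition start_heads_prog :: prog where
  "start_heads_prog = Seq (put prob_cell (Mul (Num 2) (rd (k + 1))))
     (if_drawn
       (Seq (put level_cell (Num 1)) (Seq (put coeff_cell (Div (Num 1) (Num 2))) (Seq (put limit_cell (Num 8))
         (Seq (put factor_cell (Div (Num 1) (Num 2))) (Seq (put scaling_cell (Div (rd factor_cell) (rd (k + 1)))) restart)))))
       (stop 1))"

definition heads_prog :: prog where
  "heads_prog = Cond (Less (Num 1) (rd level_cell))
     (Seq (put prob_cell (Num 1)) (if_drawn
       (Seq (put level_cell (Sub (rd level_cell) (Num 1))) (Seq (put coeff_cell (Div (rd coeff_cell) (rd factor_cell))) restart))
       (stop 0)))
     (Seq (put prob_cell (Div (rd coeff_cell) (rd factor_cell))) (if_drawn (stop 1) (stop 0)))"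

definition up_prog :: prog where
  "up_prog = Cond (Less (Add (rd level_cell) (Num 1)) (rd limit_cell))
     (Seq (put prob_cell (Num 1)) (if_drawn
       (Seq (put level_cell (Add (rd level_cell) (Num 1))) (Seq (put coeff_cell (Mul (rd coeff_cell) (rd factor_cell))) restart))
       (stop 0)))
     (Seq (put prob_cell (Mul (Num 10) (Mul (rd coeff_cell) (rd factor_cell)))) (if_drawn
       (Seq (put level_cell (Add (rd level_cell) (Num 1))) (Seq (put coeff_cell (Div (Num 1) (Num 10)))
         (Seq (put limit_cell (Mul (Num 2) (rd limit_cell))) (Seq (put factor_cell (Div (Add (Num 1) (rd factor_cell)) (Num 2)))
           (Seq (put scaling_cell (Div (rd factor_cell) (rd (k + 1)))) restart)))))
       (stop 0)))"

definition event_prog :: prog where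
  "event_prog = Cond (Less (Num 0) (rd flag_cell))
     (Cond (Less (Num 0) (rd level_cell)) heads_prog start_heads_prog)
     (Cond (Less (Num 0) (rd level_cell)) up_prog (Seq (put prob_cell (Num 0)) (if_drawn (stop 0) (stop 0))))"

definition body :: prog where
  "body = Cond (Less (rd mode_cell) (Num 1)) scan_prog
     (Cond (Less (rd mode_cell) (Num 2)) coin_prog event_prog)"

definition running :: test where
  "running = Less (rd mode_cell) (Num 3)"

definition setup_prog :: prog where
  "setup_prog = Seq (put scaling_cell (Div (Num 1) (Sub (Num 1) (Mul (Num 2) (rd (k + 1)))))) restart"

definition constants_in :: "(nat \<Rightarrow> real) \<Rightarrow> bool" where
  "constants_in m \<longleftrightarrow> (\<forall>n\<in>{1..k}. m n = C n) \<and> m (k + 1) = M"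

text \<open>The coefficient \<open>gain j * down j ^ i\<close> is stored and updated by one multiplication or division per move, so
  that \<open>survive j\<close> and \<open>gain j\<close> are obtained without computing powers or knowing the stage.\<close>

definition walk_in :: "nat \<Rightarrow> nat \<Rightarrow> (nat \<Rightarrow> real) \<Rightarrow> bool" where
  "walk_in i j m \<longleftrightarrow> constants_in m \<and> m level_cell = real i \<and> m scaling_cell = scale i j \<and>
     (0 < i \<longrightarrow> m coeff_cell = gain j * down j ^ i \<and> m limit_cell = real (top_level j) \<and> m factor_cell = down j)"

primrec represents :: "state \<Rightarrow> real \<Rightarrow> (nat \<Rightarrow> real) \<Rightarrow> bool" where
  "represents (Scan l i j) u m \<longleftrightarrow> m 0 = u \<and> m mode_cell = 0 \<and> m coin_cell = real l \<and> m rest_cell = weight l i j \<and> walk_in i j m"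
| "represents (Coin l i j) u m \<longleftrightarrow> m 0 = u \<and> m mode_cell = 1 \<and> m coin_cell = real l \<and> walk_in i j m"
| "represents (Event b i j) u m \<longleftrightarrow> m 0 = u \<and> m mode_cell = 2 \<and> m flag_cell = of_bool b \<and> walk_in i j m"
| "represents (Stop b) u m \<longleftrightarrow> m mode_cell = 3 \<and> m 0 = of_bool b"

lemma constants_in_upd [simp]: "k + 1 < a \<or> a = 0 \<Longrightarrow> constants_in (m(a := v)) \<longleftrightarrow> constants_in m"
proof -
  assume a: "k + 1 < a \<or> a = 0"
  then have "n \<in> {1..k} \<Longrightarrow> (m(a := v)) n = m n" "(m(a := v)) (k + 1) = m (k + 1)" for n by auto
  then show ?thesis unfolding constants_in_def by (metis (mono_tags, lifting))
qed

lemma effect_restart: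
  assumes "walk_in i j m" "m 0 = u"
  shows "represents (Scan 1 i j) u (effect restart m)"
proof -
  have "(\<Sum>n=1..k. (m(coin_cell := v)) n) = (\<Sum>n=1..k. C n)" for v
    using assms by (intro sum.cong refl) (auto simp: walk_in_def constants_in_def)
  then show ?thesis using assms
    by (simp add: restart_def weight_def walk_in_def)
qed

lemma restart_represents:
  assumes "s = Scan 1 i j" "walk_in i j m" "m 0 = u"
  shows "represents s u (effect restart m)"
  using effect_restart[OF assms(2,3)] assms(1) by simp

lemma effect_stop: "represents (Stop b) u (effect (stop (of_bool b)) m)"
  by (simp add: stop_def)

lemma effect_if_drawn:
  "effect (if_drawn c d) m =
    (if m 0 < m prob_cell then effect c (m(0 := m 0 / m prob_cell, result_cell := 1))
     else effect d (m(0 := (m 0 - m prob_cell) / (1 - m prob_cell), result_cell := 0)))"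
  by (simp add: if_drawn_def draw_def)

lemma straight_progs: "straight restart" "straight (stop v)" "straight scan_prog" "straight event_prog"
  "straight setup_prog"
  by (simp_all add: restart_def stop_def scan_prog_def event_prog_def heads_prog_def start_heads_prog_def
    up_prog_def if_drawn_def draw_def setup_prog_def)

lemma effect_branch:
  assumes "m 0 = u" "m prob_cell = q"
    and "\<And>v. v = u / q \<Longrightarrow> represents s1 v (effect c (m(0 := v, result_cell := 1)))"
    and "\<And>v. v = (u - q) / (1 - q) \<Longrightarrow> represents s2 v (effect d (m(0 := v, result_cell := 0)))"
  shows "if u < q then represents s1 (u / q) (effect (if_drawn c d) m)
    else represents s2 ((u - q) / (1 - q)) (effect (if_drawn c d) m)"
  using assms by (simp add: effect_if_drawn)

lemma effect_scan_prog:
  assumes l: "l \<in> {1..k}" and R: "represents (Scan l i j) u m"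
  defines "q \<equiv> scale i j * C l / weight l i j"
  defines "s2 \<equiv> if l < k then Scan (Suc l) i j else Event False i j"
  shows "if u < q then represents (Coin l i j) (u / q) (effect scan_prog m)
    else represents s2 ((u - q) / (1 - q)) (effect scan_prog m)"
proof -
  have C: "m l = C l" using R l by (simp add: walk_in_def constants_in_def)
  have W: "weight (Suc l) i j = weight l i j - scale i j * C l" using weight_step[OF l, of i j] by simp
  have l': "l \<noteq> k + a" if "0 < a" for a using l that by simp
  show ?thesis unfolding scan_prog_def effect.simps(3)
    by (rule effect_branch)
       (use R l l' in \<open>auto simp: C W q_def s2_def walk_in_def\<close>)
qed

text \<open>The cases are the moves of the walk: the first race won by heads, acceptance in level 0, one level down, the
  first race ended by the alarm, one level up within a stage, and reaching the ceiling.\<close>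

lemma effect_event_prog:
  assumes ij: "valid i j" and R: "represents (Event b i j) u m" and a: "act (Event b i j) = Branch q s1 s2"
  shows "if u < q then represents s1 (u / q) (effect event_prog m)
    else represents s2 ((u - q) / (1 - q)) (effect event_prog m)"
proof -
  have w: "walk_in i j m" and [simp]: "m 0 = u" "m mode_cell = 2" "m flag_cell = of_bool b" using R by auto
  have c: "constants_in m" and [simp]: "m level_cell = real i" "m scaling_cell = scale i j" "m (k + 1) = M" "m (Suc k) = M"
    using w by (auto simp: walk_in_def constants_in_def)
  have pos: "m coeff_cell = gain j * down j ^ i" "m limit_cell = real (top_level j)" "m factor_cell = down j" if "0 < i"
    using w that by (auto simp: walk_in_def)
  have d: "down j \<noteq> 0" using down_bounds(2)[of j] by simp
  consider "b" "i = 0" | "b" "i = 1" | "b" "1 < i" | "\<not> b" "i = 0" | "\<not> b" "0 < i" "Suc i < top_level j"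
    | "\<not> b" "0 < i" "\<not> Suc i < top_level j" by linarith
  then show ?thesis
  proof cases
    case 1
    then have e: "effect event_prog m = effect start_heads_prog m" by (simp add: event_prog_def)
    show ?thesis unfolding e start_heads_prog_def effect.simps(3)
    proof (rule effect_branch)
      show "represents s1 v (effect (Seq (put level_cell (Num 1)) (Seq (put coeff_cell (Div (Num 1) (Num 2))) (Seq (put limit_cell (Num 8))
         (Seq (put factor_cell (Div (Num 1) (Num 2))) (Seq (put scaling_cell (Div (rd factor_cell) (rd (k + 1)))) restart)))))
          ((effect (put prob_cell (Mul (Num 2) (rd (k + 1)))) m)(0 := v, result_cell := 1)))" for v
        unfolding effect.simps(3)
        by (rule restart_represents[where i="1" and j="0"])
           (use a 1 c in \<open>auto simp: walk_in_def scale_def down_0 top_level_def\<close>)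
      show "represents s2 v (effect (stop 1) ((effect (put prob_cell (Mul (Num 2) (rd (k + 1)))) m)(0 := v, result_cell := 0)))" for v
        using a 1 effect_stop[of True] by auto
    qed (use a 1 in auto)
  next
    case 2
    then have e: "effect event_prog m = effect (if_drawn (stop 1) (stop 0)) (effect (put prob_cell (Div (rd coeff_cell) (rd factor_cell))) m)"
      by (simp add: event_prog_def heads_prog_def)
    show ?thesis unfolding e
      by (rule effect_branch) (use a 2 pos d effect_stop[of True] effect_stop[of False] in auto)
  next
    case 3
    then have e: "effect event_prog m = effect (if_drawn
       (Seq (put level_cell (Sub (rd level_cell) (Num 1))) (Seq (put coeff_cell (Div (rd coeff_cell) (rd factor_cell))) restart))
       (stop 0)) (effect (put prob_cell (Num 1)) m)"
      by (simp add: event_prog_def heads_prog_def)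
    obtain n where n: "i = Suc n" "0 < n" using 3 by (cases i) auto
    show ?thesis unfolding e
    proof (rule effect_branch)
      show "represents s1 v (effect (Seq (put level_cell (Sub (rd level_cell) (Num 1))) (Seq (put coeff_cell (Div (rd coeff_cell) (rd factor_cell))) restart))
          ((effect (put prob_cell (Num 1)) m)(0 := v, result_cell := 1)))" for v
        unfolding effect.simps(3)
        by (rule restart_represents[where i="i - 1" and j=j])
           (use a 3 c pos d n in \<open>auto simp: walk_in_def scale_def\<close>)
      show "represents s2 v (effect (stop 0) ((effect (put prob_cell (Num 1)) m)(0 := v, result_cell := 0)))" for v
        using a 3 effect_stop[of False] by auto
    qed (use a 3 in auto)
  next
    case 4
    then have e: "effect event_prog m = effect (if_drawn (stop 0) (stop 0)) (effect (put prob_cell (Num 0)) m)"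
      by (simp add: event_prog_def)
    show ?thesis unfolding e
      by (rule effect_branch) (use a 4 effect_stop[of False] in auto)
  next
    case 5
    have "real i + 1 < real (top_level j)" using 5 by linarith
    then have e: "effect event_prog m = effect (if_drawn
       (Seq (put level_cell (Add (rd level_cell) (Num 1))) (Seq (put coeff_cell (Mul (rd coeff_cell) (rd factor_cell))) restart))
       (stop 0)) (effect (put prob_cell (Num 1)) m)"
      using 5 pos by (simp add: event_prog_def up_prog_def)
    show ?thesis unfolding e
    proof (rule effect_branch)
      show "represents s1 v (effect (Seq (put level_cell (Add (rd level_cell) (Num 1))) (Seq (put coeff_cell (Mul (rd coeff_cell) (rd factor_cell))) restart))
          ((effect (put prob_cell (Num 1)) m)(0 := v, result_cell := 1)))" for v
        unfolding effect.simps(3)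
        by (rule restart_represents[where i="Suc i" and j=j])
           (use a 5 c pos in \<open>auto simp: walk_in_def scale_def\<close>)
      show "represents s2 v (effect (stop 0) ((effect (put prob_cell (Num 1)) m)(0 := v, result_cell := 0)))" for v
        using a 5 effect_stop[of False] by auto
    qed (use a 5 in auto)
  next
    case 6
    then have top: "top_level j = Suc i" using ij by (auto simp: valid_def)
    have e: "effect event_prog m = effect (if_drawn
       (Seq (put level_cell (Add (rd level_cell) (Num 1))) (Seq (put coeff_cell (Div (Num 1) (Num 10)))
         (Seq (put limit_cell (Mul (Num 2) (rd limit_cell))) (Seq (put factor_cell (Div (Add (Num 1) (rd factor_cell)) (Num 2)))
           (Seq (put scaling_cell (Div (rd factor_cell) (rd (k + 1)))) restart)))))
       (stop 0)) (effect (put prob_cell (Mul (Num 10) (Mul (rd coeff_cell) (rd factor_cell)))) m)"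
      using 6 pos top by (simp add: event_prog_def up_prog_def)
    have gain: "gain (Suc j) * down (Suc j) ^ Suc i = 1 / 10"
      using down_bounds(2)[of "Suc j"] by (simp add: top[symmetric] top_level_def del: power_Suc)
    show ?thesis unfolding e
    proof (rule effect_branch)
      show "represents s1 v (effect (Seq (put level_cell (Add (rd level_cell) (Num 1))) (Seq (put coeff_cell (Div (Num 1) (Num 10)))
         (Seq (put limit_cell (Mul (Num 2) (rd limit_cell))) (Seq (put factor_cell (Div (Add (Num 1) (rd factor_cell)) (Num 2)))
           (Seq (put scaling_cell (Div (rd factor_cell) (rd (k + 1)))) restart)))))
          ((effect (put prob_cell (Mul (Num 10) (Mul (rd coeff_cell) (rd factor_cell)))) m)(0 := v, result_cell := 1)))" for v
        unfolding effect.simps(3)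
        by (rule restart_represents[where i="Suc i" and j="Suc j"])
           (use a 6 c pos gain in \<open>auto simp: walk_in_def scale_def down_Suc top_level_Suc top simp del: gain.simps power_Suc\<close>)
      show "represents s2 v (effect (stop 0) ((effect (put prob_cell (Mul (Num 10) (Mul (rd coeff_cell) (rd factor_cell)))) m)(0 := v, result_cell := 0)))" for v
        using a 6 effect_stop[of False] by auto
      show "effect (put prob_cell (Mul (Num 10) (Mul (rd coeff_cell) (rd factor_cell)))) m prob_cell = q"
        using a 6 pos top by (auto simp: survive_def)
    qed (use a 6 in auto)
  qed
qed

lemma simulates_body: "simulates represents act states running body"
  unfolding simulates_def
proof (intro ballI allI impI)
  fix s u m assume s: "s \<in> states" and R: "represents s u m"
  show "case act s of
        Halt v \<Rightarrow> \<not> holds running m \<and> m 0 = of_bool v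
      | Branch q s1 s2 \<Rightarrow> holds running m \<and> (\<exists>m'. (\<forall>x n. exec x body (m, n) (m', n)) \<and>
          (if u < q then represents s1 (u / q) m' else represents s2 ((u - q) / (1 - q)) m'))
      | Toss i s1 s2 \<Rightarrow> holds running m \<and> (\<forall>x n. \<exists>m'. exec x body (m, n) (m', n(i := Suc (n i))) \<and>
          represents (if x i (Suc (n i)) then s1 else s2) u m')"
  proof (cases s)
    case (Stop b)
    then show ?thesis using R by (simp add: running_def)
  next
    case (Scan l i j)
    have "exec x body (m, n) (effect scan_prog m, n)" for x n
      unfolding body_def using R Scan by (intro exec.if_true exec_straight straight_progs) simp
    moreover have "holds running m" using R Scan by (simp add: running_def)
    ultimately show ?thesis
      using effect_scan_prog[of l i j u m] R s unfolding Scan by (simp only: act.simps action.case states_simps) blast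
  next
    case (Event b i j)
    have "exec x body (m, n) (effect event_prog m, n)" for x n
      unfolding body_def using R Event
      by (intro exec.if_false[of _ _ _ "Cond _ _ _"] exec.if_false exec_straight straight_progs) simp_all
    moreover have "holds running m" using R Event by (simp add: running_def)
    moreover have "\<exists>q s1 s2. act s = Branch q s1 s2" by (simp add: Event)
    then obtain q s1 s2 where a: "act s = Branch q s1 s2" by blast
    ultimately show ?thesis
      using effect_event_prog[of i j b u m q s1 s2] R s a unfolding Event
      by (simp only: a[unfolded Event] action.case states_simps) blast
  next
    case (Coin l i j)
    have "\<exists>m'. exec x body (m, n) (m', n(l := Suc (n l))) \<and>
      represents (if x l (Suc (n l)) then Event True i j else Scan 1 i j) u m'" for x n
    proof -
      define m1 where "m1 = m(flag_cell := of_bool (x l (Suc (n l))))"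
      have flip: "exec x (Flip (cell flag_cell) (rd coin_cell)) (m, n) (m1, n(l := Suc (n l)))"
      proof -
        have "l = addr (val (rd coin_cell) m)" using R Coin by simp
        from exec.flip[OF this, of x "cell flag_cell" n] show ?thesis
          by (simp only: val_cell addr_of_nat m1_def)
      qed
      have w: "walk_in i j m1" "m1 0 = u" using R Coin by (auto simp: m1_def walk_in_def)
      have cond: "exec x (Cond (Less (Num 0) (rd flag_cell)) (put mode_cell (Num 2)) restart) (m1, n(l := Suc (n l)))
         (if x l (Suc (n l)) then effect (put mode_cell (Num 2)) m1 else effect restart m1, n(l := Suc (n l)))"
      proof (cases "x l (Suc (n l))")
        case True
        then have "exec x (Cond (Less (Num 0) (rd flag_cell)) (put mode_cell (Num 2)) restart) (m1, n(l := Suc (n l)))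
          (effect (put mode_cell (Num 2)) m1, n(l := Suc (n l)))"
          by (intro exec.if_true exec_straight) (simp_all add: m1_def)
        then show ?thesis using True by (simp only: if_True)
      next
        case False
        then have "exec x (Cond (Less (Num 0) (rd flag_cell)) (put mode_cell (Num 2)) restart) (m1, n(l := Suc (n l)))
          (effect restart m1, n(l := Suc (n l)))"
          by (intro exec.if_false exec_straight straight_progs) (simp_all add: m1_def)
        then show ?thesis using False by (simp only: if_False)
      qed
      have "exec x body (m, n) (if x l (Suc (n l)) then effect (put mode_cell (Num 2)) m1 else effect restart m1, n(l := Suc (n l)))"
        unfolding body_def coin_prog_def
        by (rule exec.if_false, use R Coin in simp, rule exec.if_true, use R Coin in simp, rule exec.seq[OF flip cond])
      moreover have "represents (if x l (Suc (n l)) then Event True i j else Scan 1 i j) u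
         (if x l (Suc (n l)) then effect (put mode_cell (Num 2)) m1 else effect restart m1)"
      proof (cases "x l (Suc (n l))")
        case True
        then have "represents (Event True i j) u (effect (put mode_cell (Num 2)) m1)"
          using w by (auto simp: walk_in_def m1_def)
        then show ?thesis using True by (simp only: if_True)
      next
        case False
        then show ?thesis using effect_restart[OF w] by (simp only: if_False)
      qed
      ultimately show ?thesis by blast
    qed
    moreover have "holds running m" using R Coin by (simp add: running_def)
    ultimately show ?thesis by (simp only: Coin act.simps action.case) blast
  qed
qed

lemma setup_represents:
  fixes u :: real
  assumes cs: "cs = map C [1..<Suc k] @ [M]"
  defines "m \<equiv> effect setup_prog (fst (init (u # cs)))"
  shows "exec x setup_prog (init (u # cs)) (m, \<lambda>_. 0)" "represents (Scan 1 0 0) u m"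
proof -
  show "exec x setup_prog (init (u # cs)) (m, \<lambda>_. 0)"
    using exec_straight[OF straight_progs(5), of x "fst (init (u # cs))" "\<lambda>_. 0"] by (simp add: m_def init_def)
  have len: "length cs = k + 1" by (simp add: cs)
  have "constants_in (fst (init (u # cs)))"
    using cs len by (auto simp: constants_in_def init_def nth_append nth_Cons split: nat.splits simp del: upt_Suc)
  then have "walk_in 0 0 ((fst (init (u # cs)))(scaling_cell := 1 / (1 - 2 * M)))"
    using len by (auto simp: walk_in_def scale_def init_def)
  moreover have "fst (init (u # cs)) (Suc k) = M" using \<open>constants_in _\<close> by (simp add: constants_in_def)
  ultimately show "represents (Scan 1 0 0) u m"
    unfolding m_def setup_prog_def effect.simps(3)
    by (intro effect_restart) (auto simp: init_def)
qed

end

section \<open>The factory\<close>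

lemma (in small_mean) factory:
  defines "r \<equiv> \<lambda>p. \<Sum>i=1..k. C i * p i" and "cs \<equiv> map C [1..<Suc k] @ [M]"
  defines "D \<equiv> {p \<in> {1..k} \<rightarrow>\<^sub>E {0..1}. r p \<le> M}"
  defines "Ctot \<equiv> \<Sum>i=1..k. C i"
  shows "multivariate_bernoulli_factory k cs D r (\<lambda>\<omega>. halts_with act (Scan 1 0 0, \<omega>) True) (flips act (Scan 1 0 0))"
    and "\<forall>p\<in>D. expected_flips k p (flips act (Scan 1 0 0)) \<le>
              ennreal (Ctot / ((1 - 2 * M) * (1 + r p)) + r p * (Ctot * (15.2 / (1 - 2 * M + r p))))"
proof -
  have coins: "small_mean_coins k C M p (r p)" if "p \<in> D" for p
    using that by unfold_locales (auto simp: D_def r_def)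
  have S: "legal k act states" by (rule legal_act)
  have s: "Scan 1 0 0 \<in> states" using k by (simp add: valid_def)
  have D: "D \<subseteq> {1..k} \<rightarrow>\<^sub>E {0..1}" by (auto simp: D_def)
  have r01: "r \<in> D \<rightarrow> {0..1}"
  proof
    fix p assume p: "p \<in> D"
    interpret P: small_mean_coins k C M p "r p" by (rule coins[OF p])
    show "r p \<in> {0..1}" using P.r_nonneg P.r(2) M by simp
  qed
  have comp: "computable_fun k cs D r" unfolding cs_def r_def by (rule computable_linear)
  have prog: "runs_to k cs (Seq setup_prog (While running body)) \<omega> v \<longleftrightarrow> (\<exists>b. halts_with act (Scan 1 0 0, \<omega>) b \<and> v = of_bool b)"
    for \<omega> v
    using setup_represents[where cs=cs and u="fst \<omega>"] 
    by (intro runs_to_iff_halts_with[OF simulates_body S s]) (simp_all add: cs_def)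
  define h where "h p b s = ennreal ((if b then small_mean_coins.extend k C M p 0 0 (small_mean_coins.target M (r p)) of_bool
      else small_mean_coins.extend k C M p 0 0 (\<lambda>i j. 1 - small_mean_coins.target M (r p) i j) (\<lambda>b. 1 - of_bool b)) s)" for p b s
  define W where "W p s = ennreal (small_mean_coins.extend k C M p 0 1 (small_mean_coins.cost k C M (r p) 0 1) (\<lambda>_. 0) s)" for p s
  show "multivariate_bernoulli_factory k cs D r (\<lambda>\<omega>. halts_with act (Scan 1 0 0, \<omega>) True) (flips act (Scan 1 0 0))"
  proof (rule protocol_factory[OF S s D r01 comp prog, where h=h and W=W])
    fix p b s assume p: "p \<in> D" and s: "s \<in> states"
    interpret P: small_mean_coins k C M p "r p" by (rule coins[OF p])
    show "average p act (h p b) s \<le> h p b s"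
      using P.target_supersolution[OF s, of b] unfolding h_def by simp
    show "1 \<le> h p b s" if "act s = Halt b"
    proof -
      have "s = Stop b" using that by (cases s) (auto split: if_splits)
      then show ?thesis by (cases b) (simp_all add: h_def)
    qed
  next
    fix p assume p: "p \<in> D"
    interpret P: small_mean_coins k C M p "r p" by (rule coins[OF p])
    show "h p True (Scan 1 0 0) \<le> ennreal (r p)" "h p False (Scan 1 0 0) \<le> ennreal (1 - r p)"
      using P.extend_target_start unfolding h_def by (simp_all add: ennreal_leI del: P.extend.simps)
    show "W p (Scan 1 0 0) < \<infinity>" by (simp add: W_def)
  next
    fix p s assume p: "p \<in> D" and s: "s \<in> states"
    interpret P: small_mean_coins k C M p "r p" by (rule coins[OF p])
    have "(if \<exists>b. act s = Halt b then 0 else 1) = ennreal (price 0 1 (act s))"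
      by (cases "act s") (simp_all add: price_def)
    then show "(if \<exists>b. act s = Halt b then 0 else 1) + average p act (W p) s \<le> W p s"
      using P.cost_supersolution[of 0 1 s] s unfolding W_def by simp
  qed
  show "\<forall>p\<in>D. expected_flips k p (flips act (Scan 1 0 0)) \<le>
              ennreal (Ctot / ((1 - 2 * M) * (1 + r p)) + r p * (Ctot * (15.2 / (1 - 2 * M + r p))))"
  proof
    fix p assume p: "p \<in> D"
    interpret P: small_mean_coins k C M p "r p" by (rule coins[OF p])
    have "expected_flips k p (flips act (Scan 1 0 0)) \<le> ennreal (P.extend 1 0 (P.cost 1 0) (\<lambda>_. 0) (Scan 1 0 0))"
    proof (rule expected_flips_bound[OF S s P.p])
      fix s assume "s \<in> states"
      moreover have "(case act s of Toss i s1 s2 \<Rightarrow> 1 | _ \<Rightarrow> 0) = ennreal (price 1 0 (act s))"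
        by (cases "act s") (simp_all add: price_def)
      ultimately show "(case act s of Toss i s1 s2 \<Rightarrow> 1 | _ \<Rightarrow> 0) + average p act (\<lambda>s. ennreal (P.extend 1 0 (P.cost 1 0) (\<lambda>_. 0) s)) s
          \<le> ennreal (P.extend 1 0 (P.cost 1 0) (\<lambda>_. 0) s)"
        using P.cost_supersolution[of 1 0 s] by simp
    qed
    also have "\<dots> \<le> ennreal (Ctot / ((1 - 2 * M) * (1 + r p)) + r p * (Ctot * (15.2 / (1 - 2 * M + r p))))"
      using P.flip_cost_start unfolding P.Ctot_def Ctot_def by (rule ennreal_leI)
    finally show "expected_flips k p (flips act (Scan 1 0 0)) \<le>
        ennreal (Ctot / ((1 - 2 * M) * (1 + r p)) + r p * (Ctot * (15.2 / (1 - 2 * M + r p))))" .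
  qed
qed

text \<open>The factory for \<open>M \<le> 0\<close>, where only parameters with \<open>r = 0\<close> are admissible.\<close>

lemma zero_factory:
  assumes D: "D \<subseteq> {1..k} \<rightarrow>\<^sub>E {0..1}" and f: "\<And>p. p \<in> D \<Longrightarrow> f p = 0" "computable_fun k cs D f"
  shows "multivariate_bernoulli_factory k cs D f (\<lambda>\<omega>. halts_with Halt (False, \<omega>) True) (flips Halt False)"
    and "p \<in> D \<Longrightarrow> expected_flips k p (flips Halt False) = 0"
proof -
  have S: "legal k Halt {False}" by (simp add: legal_def)
  have sim: "simulates (\<lambda>s u m. m 0 = of_bool s) Halt {False} (Less (Num 0) (Num 0)) (Store (Num 0) (Num 0))"
    by (simp add: simulates_def)
  have prog: "runs_to k cs (Seq (put 0 (Num 0)) (While (Less (Num 0) (Num 0)) (Store (Num 0) (Num 0)))) \<omega> v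
     \<longleftrightarrow> (\<exists>b. halts_with Halt (False, \<omega>) b \<and> v = of_bool b)" for \<omega> v
  proof (rule runs_to_iff_halts_with[OF sim S])
    show "exec x (put 0 (Num 0)) (init (fst \<omega> # cs)) (effect (put 0 (Num 0)) (fst (init (fst \<omega> # cs))), \<lambda>_. 0)" for x
      using exec_straight[of "put 0 (Num 0)" x "fst (init (fst \<omega> # cs))" "\<lambda>_. 0"] by (simp add: init_def)
  qed simp_all
  show "multivariate_bernoulli_factory k cs D f (\<lambda>\<omega>. halts_with Halt (False, \<omega>) True) (flips Halt False)"
    by (rule protocol_factory[OF S _ D _ f(2) prog, where h="\<lambda>p b s. if s = b then 1 else 0" and W="\<lambda>_ _. 0"])
       (use f(1) in \<open>auto simp: average_def\<close>)
  have "flips Halt False i \<omega> = 0" for i and \<omega> :: input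
    by (simp add: flips_def accrued_def tossed_def zero_enat_def[symmetric])
  then show "expected_flips k p (flips Halt False) = 0"
    by (simp add: expected_flips_def)
qed

theorem theorem2:
  fixes k :: nat and C :: "nat \<Rightarrow> real" and M :: real
  defines "r \<equiv> \<lambda>p :: nat \<Rightarrow> real. \<Sum>i=1..k. C i * p i"
    and "Ctot \<equiv> \<Sum>i=1..k. C i"
    and "cs \<equiv> map C [1..<Suc k] @ [M]"
  defines "D \<equiv> {p \<in> {1..k} \<rightarrow>\<^sub>E {0..1}. r p \<le> M}"
  assumes "k \<ge> 1" and "\<forall>i\<in>{1..k}. C i > 0" and "M < 1/2"
  shows "\<exists>A T. multivariate_bernoulli_factory k cs D r A T \<and>
           (\<forall>p\<in>D. expected_flips k p T \<le>
              ennreal (Ctot / ((1 - 2 * M) * (1 + r p)) + r p * (Ctot * (15.2 / (1 - 2 * M + r p)))))"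
proof (cases "0 < M")
  case True
  then interpret small_mean k C M
    using assms(5-7) by unfold_locales auto
  show ?thesis
    unfolding r_def Ctot_def cs_def D_def by (intro exI conjI) (rule factory)+
next
  case False
  have r: "r p = 0" if "p \<in> D" for p
  proof -
    have "0 \<le> r p" unfolding r_def
      using that assms(6) by (intro sum_nonneg mult_nonneg_nonneg) (auto simp: D_def PiE_iff less_imp_le)
    then show ?thesis using that False by (simp add: D_def)
  qed
  have "D \<subseteq> {1..k} \<rightarrow>\<^sub>E {0..1}" by (auto simp: D_def)
  moreover have "computable_fun k cs D r" unfolding cs_def r_def by (rule computable_linear)
  ultimately show ?thesis using zero_factory[of D k r cs] r by (metis zero_le)
qed

end
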